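(* Let $n\geq 2$ be even, let $u\in F_n$ be a non-empty reduced word, let $w=u\,\theta^{n/2}(u)^{-1}$ be a word of length $k$ that is alternating and not a proper power, and suppose that $P_n(w)$ is irreducible. Then $P_n(w)$ is $(2,k,\nu)$-special if and only if $l(u)=n/2\geq 3$ is odd, $\nu=2$, and $\bar{\mathcal{A}},\bar{\mathcal{B}}$ are each sets of the form $\{\pm1,\pm3,\ldots,\pm(n-4)/2,\ n/2\}$.
   Context: $F_n$ is the free group with basis $x_0,\ldots,x_{n-1}$; subscripts are taken modulo $n$; $\theta(x_i)=x_{i+1}$; $l(u)$ is the length of $u$. $P_n(w)=\langle x_0,\ldots,x_{n-1}\mid w,\theta(w),\ldots,\theta^{n-1}(w)\rangle$. $P_n(w)$ is irreducible if the greatest common divisor of $n$ and all differences of subscripts of letters occurring in $w$ is $1$. A word of length at least 2 is alternating if it has no subword of the form $(x_ix_j)^{\pm1}$. Multisets (of residues mod $n$, counted with multiplicity): $\bar{\mathcal{A}}'=\{a\mid$ there is a subword $x_ix_{i+a}^{-1}$ of $u\}$; $\bar{\mathcal{B}}'=\{b\mid$ there is a subword $x_i^{-1}x_{i+b}$ of $u\}$. Let $\iota(u),\tau(u)$ be the initial and terminal letters of $u$ (a letter $x_i$ is positive, $x_i^{-1}$ is negative). With $\cup$ denoting multiset sum, $(\bar{\mathcal{A}},\bar{\mathcal{B}})$ equals: $(\bar{\mathcal{A}}'\cup\{n/2\},\bar{\mathcal{B}}'\cup\{n/2\})$ if $\iota(u),\tau(u)$ are both positive or both negative; $(\bar{\mathcal{A}}',\bar{\mathcal{B}}'\cup\{n/2,n/2\})$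 if $\iota(u)$ is positive and $\tau(u)$ negative; $(\bar{\mathcal{A}}'\cup\{n/2,n/2\},\bar{\mathcal{B}}')$ if $\iota(u)$ is negative and $\tau(u)$ positive. Saying such a multiset is a "set of the form $\{\pm c_1,\ldots,\pm c_r,n/2\}$" means that it has no repeated elements and, mod $n$, consists of $n/2$ and exactly one of $c_j,-c_j$ for each $j$ (each sign being chosen independently). Star graph: for a presentation $\langle X\mid R\rangle$ with cyclically reduced relators, let $\tilde R$ be the set of all cyclic permutations of elements of $R\cup R^{-1}$. The star graph is the undirected graph (multiple edges allowed) with vertex set $X\cup X^{-1}$ and an edge joining $x$ and $y$ ($x,y\in X\cup X^{-1}$) for each distinct word in $\tilde R$ of the form $xy^{-1}z$, where the edges arising from the inverse pair $xy^{-1}z$ and $yx^{-1}z^{-1}$ are identified. $(m,k,\nu)$-special: let $m\geq 2$, $k\geq 3$, $\nu\geq 1$. A finite presentation is $(m,k,\nu)$-special if (a) its star graph has $\nu$ connected components, which are pairwise isomorphic, each being a connected bipartite graph of diameter $m$ and girth $2m$ in which each vertex has degree at least $3$; (b) each relator has length $k$; (c) if $m=2$ then $k\geq 4$. (Girth is the minimal length of a reduced closed path; a pair of parallel edges gives girth at most $2$.) *)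

theory Defs
  imports "HOL-Algebra.Group" "HOL-Library.Multiset" "HOL-Library.Sublist" "HOL-Library.Extended_Nat"
begin

section \<open>Free groups, as groups of reduced words\<close>

text \<open>\<open>Pos i\<close> stands for the generator \<open>i\<close> and \<open>Neg i\<close> for its inverse.\<close>

datatype 'a letter = Pos (subscript: 'a) | Neg (subscript: 'a)

type_synonym 'a word = "'a letter list"

fun letter_inv :: "'a letter \<Rightarrow> 'a letter" where
  "letter_inv (Pos i) = Neg i"
| "letter_inv (Neg i) = Pos i"

definition letters_over :: "'a set \<Rightarrow> 'a letter set" where
  "letters_over X = Pos ` X \<union> Neg ` X"

definition word_inv :: "'a word \<Rightarrow> 'a word" where
  "word_inv w = rev (map letter_inv w)"

definition reduced :: "'a word \<Rightarrow> bool" where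
  "reduced w \<longleftrightarrow> (\<forall>x. \<not> sublist [x, letter_inv x] w)"

definition cyclically_reduced :: "'a word \<Rightarrow> bool" where
  "cyclically_reduced w \<longleftrightarrow> (\<forall>i. reduced (rotate i w))"

fun cons_reduce :: "'a letter \<Rightarrow> 'a word \<Rightarrow> 'a word" where
  "cons_reduce x [] = [x]"
| "cons_reduce x (y # ys) = (if y = letter_inv x then ys else x # y # ys)"

definition free_reduce :: "'a word \<Rightarrow> 'a word" where
  "free_reduce w = foldr cons_reduce w []"

definition free_group :: "'a set \<Rightarrow> 'a word monoid" where
  "free_group X = \<lparr>carrier = {w \<in> lists (letters_over X). reduced w},
                   monoid.mult = (\<lambda>v w. free_reduce (v @ w)), one = []\<rparr>"

definition proper_power :: "('a, 'b) monoid_scheme \<Rightarrow> 'a \<Rightarrow> bool" where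
  "proper_power G w \<longleftrightarrow> (\<exists>v\<in>carrier G. \<exists>m::nat. m \<ge> 2 \<and> w = v [^]\<^bsub>G\<^esub> m)"

definition alternating :: "'a word \<Rightarrow> bool" where
  "alternating w \<longleftrightarrow> length w \<ge> 2 \<and>
     (\<forall>i j. \<not> sublist [Pos i, Pos j] w \<and> \<not> sublist (word_inv [Pos i, Pos j]) w)"


section \<open>Undirected multigraphs\<close>

text \<open>\<open>ends e\<close> is the set of endpoints of the edge \<open>e\<close>; it is a singleton if \<open>e\<close> is a loop.\<close>

record ('v, 'e) multigraph =
  verts :: "'v set"
  edges :: "'e set"
  ends :: "'e \<Rightarrow> 'v set"

fun walk :: "('v, 'e) multigraph \<Rightarrow> 'v \<Rightarrow> 'e list \<Rightarrow> 'v \<Rightarrow> bool" where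
  "walk G x [] y \<longleftrightarrow> x \<in> verts G \<and> x = y"
| "walk G x (e # es) y \<longleftrightarrow> x \<in> verts G \<and> e \<in> edges G \<and> (\<exists>z. ends G e = {x, z} \<and> walk G z es y)"

definition connected_graph :: "('v, 'e) multigraph \<Rightarrow> bool" where
  "connected_graph G \<longleftrightarrow> verts G \<noteq> {} \<and> (\<forall>x\<in>verts G. \<forall>y\<in>verts G. \<exists>es. walk G x es y)"

definition induced :: "('v, 'e) multigraph \<Rightarrow> 'v set \<Rightarrow> ('v, 'e) multigraph" where
  "induced G S = \<lparr>verts = S, edges = {e \<in> edges G. ends G e \<subseteq> S}, ends = ends G\<rparr>"

definition components :: "('v, 'e) multigraph \<Rightarrow> ('v, 'e) multigraph set" where
  "components G = (\<lambda>x. induced G {y. \<exists>es. walk G x es y}) ` verts G"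

definition graph_iso :: "('v, 'e) multigraph \<Rightarrow> ('w, 'f) multigraph \<Rightarrow> bool" where
  "graph_iso G H \<longleftrightarrow> (\<exists>f g. bij_betw f (verts G) (verts H) \<and> bij_betw g (edges G) (edges H) \<and>
     (\<forall>e\<in>edges G. ends H (g e) = f ` ends G e))"

definition bipartite :: "('v, 'e) multigraph \<Rightarrow> bool" where
  "bipartite G \<longleftrightarrow> (\<exists>S\<subseteq>verts G. \<forall>e\<in>edges G. \<exists>x\<in>S. \<exists>y\<in>verts G - S. ends G e = {x, y})"

definition distance :: "('v, 'e) multigraph \<Rightarrow> 'v \<Rightarrow> 'v \<Rightarrow> enat" where
  "distance G x y = (INF es\<in>{es. walk G x es y}. enat (length es))"

definition diameter :: "('v, 'e) multigraph \<Rightarrow> enat" where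
  "diameter G = (SUP (x, y)\<in>verts G \<times> verts G. distance G x y)"

text \<open>Equality of consecutive edges expresses backtracking, except along a loop, which can be
  traversed twice in the same direction; this does not affect the girth, which is then 1.\<close>

definition girth :: "('v, 'e) multigraph \<Rightarrow> enat" where
  "girth G = (INF es\<in>{es. es \<noteq> [] \<and> distinct_adj es \<and> (\<exists>x. walk G x es x)}. enat (length es))"

text \<open>Loops are counted twice.\<close>

definition degree :: "('v, 'e) multigraph \<Rightarrow> 'v \<Rightarrow> nat" where
  "degree G x = card {e \<in> edges G. x \<in> ends G e} + card {e \<in> edges G. ends G e = {x}}"


section \<open>Presentations and star graphs\<close>

text \<open>A presentation is a pair of a set of generators and a set of relators.\<close>

type_synonym 'a presentation = "'a set \<times> 'a word set"

fun finite_presentation :: "'a presentation \<Rightarrow> bool" where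
  "finite_presentation (X, R) \<longleftrightarrow> finite X \<and> finite R \<and> R \<subseteq> carrier (free_group X)"

definition symmetrized :: "'a word set \<Rightarrow> 'a word set" where
  "symmetrized R = {rotate i r | i r. r \<in> R \<union> word_inv ` R}"

text \<open>An edge of the star graph is the set consisting of a word \<open>x y\<^sup>-\<^sup>1 z\<close> and the word
  \<open>y x\<^sup>-\<^sup>1 z\<^sup>-\<^sup>1\<close> that is identified with it. The endpoints \<open>x\<close>, \<open>y\<close> are the first letters of
  these two words.\<close>

fun star_graph :: "'a presentation \<Rightarrow> ('a letter, 'a word set) multigraph" where
  "star_graph (X, R) =
     \<lparr>verts = letters_over X,
      edges = {{x # letter_inv y # z, y # letter_inv x # word_inv z} | x y z.
                 x # letter_inv y # z \<in> symmetrized R},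
      ends = (\<lambda>e. hd ` e)\<rparr>"

definition special :: "nat \<Rightarrow> nat \<Rightarrow> nat \<Rightarrow> 'a presentation \<Rightarrow> bool" where
  "special m k \<nu> P \<longleftrightarrow>
     m \<ge> 2 \<and> k \<ge> 3 \<and> \<nu> \<ge> 1 \<and>
     finite_presentation P \<and> (\<forall>r\<in>snd P. cyclically_reduced r) \<and>
     card (components (star_graph P)) = \<nu> \<and>
     (\<forall>C\<in>components (star_graph P). \<forall>D\<in>components (star_graph P). graph_iso C D) \<and>
     (\<forall>C\<in>components (star_graph P).
        connected_graph C \<and> bipartite C \<and> diameter C = enat m \<and> girth C = enat (2 * m) \<and>
        (\<forall>x\<in>verts C. degree C x \<ge> 3)) \<and>
     (\<forall>r\<in>snd P. length r = k) \<and>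
     (m = 2 \<longrightarrow> k \<ge> 4)"


section \<open>Cyclic presentations\<close>

text \<open>The generator \<open>x\<^sub>i\<close> is represented by its subscript, a residue in \<open>{0..<n}\<close>.\<close>

definition cyc_gens :: "nat \<Rightarrow> int set" where
  "cyc_gens n = {0..<int n}"

definition shift :: "nat \<Rightarrow> int word \<Rightarrow> int word" where
  "shift n w = map (map_letter (\<lambda>i. (i + 1) mod int n)) w"

definition cyclic_presentation :: "nat \<Rightarrow> int word \<Rightarrow> int presentation" where
  "cyclic_presentation n w = (cyc_gens n, {(shift n ^^ i) w | i. i < n})"

definition irreducible_presentation :: "nat \<Rightarrow> int word \<Rightarrow> bool" where
  "irreducible_presentation n w \<longleftrightarrow>
     Gcd (insert (int n) {subscript x - subscript y | x y. x \<in> set w \<and> y \<in> set w}) = 1"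

text \<open>The pairs in \<open>zip u (tl u)\<close> are the occurrences of subwords of length 2 of \<open>u\<close>; the list
  comprehensions skip those that do not match the pattern.\<close>

definition A_prime :: "nat \<Rightarrow> int word \<Rightarrow> int multiset" where
  "A_prime n u = mset [(j - i) mod int n. (Pos i, Neg j) \<leftarrow> zip u (tl u)]"

definition B_prime :: "nat \<Rightarrow> int word \<Rightarrow> int multiset" where
  "B_prime n u = mset [(j - i) mod int n. (Neg i, Pos j) \<leftarrow> zip u (tl u)]"

definition AB_bar :: "nat \<Rightarrow> int word \<Rightarrow> int multiset \<times> int multiset" where
  "AB_bar n u =
     (let h = int n div 2 in
      case (hd u, last u) of
        (Pos _, Neg _) \<Rightarrow> (A_prime n u, B_prime n u + {#h, h#})
      | (Neg _, Pos _) \<Rightarrow> (A_prime n u + {#h, h#}, B_prime n u)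
      | _ \<Rightarrow> (A_prime n u + {#h#}, B_prime n u + {#h#}))"

text \<open>\<open>M\<close>, a multiset of residues in \<open>{0..<n}\<close>, is a set of the form \<open>{\<plusminus>c | c \<in> C} \<union> {n/2}\<close>,
  with one sign \<open>\<epsilon> c\<close> chosen for each \<open>c\<close>.\<close>

definition pm_form :: "nat \<Rightarrow> int set \<Rightarrow> int multiset \<Rightarrow> bool" where
  "pm_form n C M \<longleftrightarrow> (\<forall>x. count M x \<le> 1) \<and>
     (\<exists>\<epsilon> :: int \<Rightarrow> int. (\<forall>c\<in>C. \<epsilon> c \<in> {1, -1}) \<and>
        set_mset M = insert (int n div 2) ((\<lambda>c. (\<epsilon> c * c) mod int n) ` C))"

end

theory Submission
  imports Defs
begin

text \<open>Extend \<open>w\<close> to a periodic two-sided sequence of letters. Since \<open>w = u \<theta>\<^bsup>n/2\<^esup>(u)\<^sup>-\<^sup>1\<close>, reflecting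
  positions inverts letters up to \<open>\<theta>\<^bsup>n/2\<^esup>\<close>; with \<open>w\<close> not a proper power, this forces all the
  cyclic permutations of the relators \<open>\<theta>\<^sup>i(w)\<close> to be distinct. As \<open>w\<close> alternates, the star graph
  splits into a positive and a negative part; each is a Cayley multigraph of the integers mod \<open>n\<close>,
  whose connection multiset consists of the subscript differences at the positions of one parity.

  Girth 4 makes each connection multiset a set \<open>D\<close> of size \<open>l(u)\<close>, whence \<open>n/2\<close>, which is the
  difference at both junctions of \<open>u\<close> and \<open>\<theta>\<^bsup>n/2\<^esup>(u)\<^sup>-\<^sup>1\<close>, occurs once in each and \<open>l(u)\<close> is odd.
  Bipartite of diameter 2 means that \<open>D\<close> is closed under sums of three elements; hence \<open>D + n/2\<close> is
  a subgroup of order \<open>l(u)\<close>, so \<open>n\<close> divides \<open>l(u) (a + n/2)\<close> for \<open>a \<in> D\<close>. Irreducibility then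
  yields that \<open>n\<close> divides \<open>2 l(u)\<close>, and a count gives \<open>l(u) = n/2\<close> and that \<open>D\<close> is the set of odd residues.
  Conversely, if \<open>D\<close> consists of the odd residues then each part is a complete bipartite graph.
  Off the junctions, reflection pairs each difference \<open>a\<close> within \<open>u\<close> with \<open>-a\<close>, which translates
  the condition on \<open>D\<close> into the one on \<open>\<A>\<close> and \<open>\<B>\<close>.\<close>

section \<open>Words\<close>

lemma letter_inv_letter_inv [simp]: "letter_inv (letter_inv x) = x"
  by (cases x) auto

lemma letter_inv_eq_iff [simp]: "letter_inv x = letter_inv y \<longleftrightarrow> x = y"
  by (metis letter_inv_letter_inv)

lemma subscript_letter_inv [simp]: "subscript (letter_inv x) = subscript x"
  by (cases x) auto

lemma length_word_inv [simp]: "length (word_inv w) = length w"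
  by (simp add: word_inv_def)

lemma nth_word_inv: "i < length w \<Longrightarrow> word_inv w ! i = letter_inv (w ! (length w - 1 - i))"
  by (simp add: word_inv_def rev_nth)

lemma sublist_pair_iff:
  "sublist [x, y] w \<longleftrightarrow> (\<exists>i. Suc i < length w \<and> w ! i = x \<and> w ! Suc i = y)"
proof
  assume "sublist [x, y] w"
  then obtain ps ss where w: "w = ps @ [x, y] @ ss" by (auto simp: sublist_def)
  show "\<exists>i. Suc i < length w \<and> w ! i = x \<and> w ! Suc i = y"
    by (rule exI[of _ "length ps"]) (simp add: w nth_append)
next
  assume "\<exists>i. Suc i < length w \<and> w ! i = x \<and> w ! Suc i = y"
  then obtain i where "Suc i < length w" "w ! i = x" "w ! Suc i = y" by blast
  then have "w = take i w @ [x, y] @ drop (Suc (Suc i)) w"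
    by (metis Cons_eq_appendI Cons_nth_drop_Suc Suc_lessD append_Nil append_take_drop_id)
  then show "sublist [x, y] w" unfolding sublist_def by blast
qed

lemma reduced_iff_nth:
  "reduced w \<longleftrightarrow> (\<forall>i. Suc i < length w \<longrightarrow> w ! Suc i \<noteq> letter_inv (w ! i))"
  unfolding reduced_def sublist_pair_iff by metis

section \<open>Reduced words and powers in the free group\<close>

lemma reduced_Cons: "reduced (x # w) \<Longrightarrow> reduced w"
  unfolding reduced_def by (metis sublist_Cons_right)

lemma reduced_take: "reduced w \<Longrightarrow> reduced (take i w)"
  by (simp add: reduced_iff_nth)

lemma free_reduce_reduced: "reduced w \<Longrightarrow> free_reduce w = w"
proof (induction w)
  case Nil
  then show ?case by (simp add: free_reduce_def)
next
  case (Cons x w)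
  have "free_reduce (x # w) = cons_reduce x (free_reduce w)"
    by (simp add: free_reduce_def)
  also have "\<dots> = cons_reduce x w"
    using Cons reduced_Cons by metis
  also have "\<dots> = x # w"
  proof (cases w)
    case (Cons y ys)
    then have "y \<noteq> letter_inv x"
      using Cons.prems unfolding reduced_iff_nth by fastforce
    then show ?thesis using Cons by simp
  qed simp
  finally show ?case .
qed

text \<open>Prefixes of a reduced word are reduced, so no stage of the power involves a
  cancellation.\<close>

lemma free_group_pow:
  assumes "reduced (concat (replicate m v))"
  shows "v [^]\<^bsub>free_group X\<^esub> m = concat (replicate m v)"
  using assms
proof (induction m)
  case 0
  then show ?case by (simp add: nat_pow_def free_group_def)
next
  case (Suc m)
  have eq: "concat (replicate (Suc m) v) = concat (replicate m v) @ v"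
    by (metis append_Nil2 concat.simps concat_append replicate_Suc replicate_append_same)
  have "reduced (concat (replicate m v))"
    using reduced_take[OF Suc.prems, of "length (concat (replicate m v))"] unfolding eq by simp
  then have "v [^]\<^bsub>free_group X\<^esub> Suc m = free_reduce (concat (replicate m v) @ v)"
    using Suc.IH by (simp add: nat_pow_def free_group_def)
  then show ?case
    using Suc.prems free_reduce_reduced unfolding eq by metis
qed

text \<open>A rotation fixing \<open>w\<close> makes its two pieces commute as words, so both are
  powers of one word \<open>v\<close>. As \<open>w\<close> is reduced, the word power is also the
  power in the free group.\<close>

lemma proper_power_if_rotate_eq:
  assumes w: "w \<in> carrier (free_group X)" and ne: "w \<noteq> []" and rot: "rotate r w = w" and r: "\<not> length w dvd r"
  shows "proper_power (free_group X) w"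
proof -
  define q where "q = r mod length w"
  have q: "0 < q" "q < length w"
    using r ne by (auto simp: q_def mod_greater_zero_iff_not_dvd)
  have "drop q w @ take q w = w"
    using rot by (simp add: rotate_drop_take q_def)
  then have "take q w @ drop q w = drop q w @ take q w" by simp
  then obtain a b v where a: "concat (replicate a v) = take q w" and b: "concat (replicate b v) = drop q w"
    using comm_append_are_replicate by blast
  have "a \<noteq> 0" "b \<noteq> 0" using a b q by (metis concat.simps(1) replicate_0 take_eq_Nil drop_eq_Nil not_le neq0_conv
      list.size(3) not_less0)+
  then have ab: "a + b \<ge> 2" by linarith
  have wv: "w = concat (replicate (a + b) v)"
    by (metis a b append_take_drop_id concat_append replicate_add)
  have red: "reduced w" using w by (simp add: free_group_def)
  have vw: "take (length v) w = v"
    using wv ab by (cases "a + b") auto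
  have "v \<in> carrier (free_group X)"
    using w reduced_take[OF red, of "length v"] unfolding vw
    by (auto simp: free_group_def) (metis in_set_takeD vw)
  then show ?thesis
    unfolding proper_power_def using ab wv red free_group_pow by metis
qed

section \<open>Signs of letters\<close>

fun positive :: "'a letter \<Rightarrow> bool" where
  "positive (Pos i) = True"
| "positive (Neg i) = False"

lemma letter_eq_iff: "x = y \<longleftrightarrow> positive x = positive y \<and> subscript x = subscript y"
  by (cases x; cases y) auto

lemma positive_letter_inv [simp]: "positive (letter_inv x) \<longleftrightarrow> \<not> positive x"
  by (cases x) auto

lemma alternating_nth:
  assumes "alternating w" and "Suc i < length w"
  shows "positive (w ! Suc i) \<longleftrightarrow> \<not> positive (w ! i)"
proof -
  have "sublist [w ! i, w ! Suc i] w" unfolding sublist_pair_iff using assms(2) by auto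
  moreover have "\<not> sublist [Pos a, Pos b] w" "\<not> sublist [Neg a, Neg b] w" for a b
    using assms(1) unfolding alternating_def by (simp_all add: word_inv_def)
  ultimately show ?thesis by (cases "w ! i"; cases "w ! Suc i") simp_all
qed

lemma letters_over_iff: "x \<in> letters_over X \<longleftrightarrow> subscript x \<in> X"
  by (cases x) (auto simp: letters_over_def)

text \<open>A list comprehension with a pattern unfolds to such a concatenation; this is how
  \<open>A_prime\<close> and \<open>B_prime\<close> become images over sets of positions.\<close>

lemma mset_concat_if_singleton:
  "mset (concat (map (\<lambda>i. if P i then [f i] else []) xs)) = image_mset f (filter_mset P (mset xs))"
  by (induction xs) auto

section \<open>Multigraphs\<close>

lemma walk_in_verts: "walk G x es y \<Longrightarrow> x \<in> verts G \<and> y \<in> verts G"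
  by (induction es arbitrary: x) auto

lemma walk_append: "walk G x es y \<Longrightarrow> walk G y fs z \<Longrightarrow> walk G x (es @ fs) z"
  by (induction es arbitrary: x) auto

text \<open>Each edge changes sides, so only the parity of the length matters.\<close>

lemma walk_bipartite:
  assumes "\<forall>e\<in>edges G. \<exists>x\<in>S. \<exists>y\<in>verts G - S. ends G e = {x, y}" and "walk G x es y"
  shows "(x \<in> S \<longleftrightarrow> y \<in> S) \<longleftrightarrow> even (length es)"
  using assms(2)
proof (induction es arbitrary: x)
  case (Cons e es)
  then obtain z where "e \<in> edges G" "ends G e = {x, z}" "walk G z es y" by auto
  moreover from this obtain a b where "a \<in> S" "b \<notin> S" "ends G e = {a, b}"
    using assms(1) by blast
  ultimately have "x \<in> S \<longleftrightarrow> z \<notin> S" by (auto simp: doubleton_eq_iff)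
  then show ?case using Cons.IH[OF \<open>walk G z es y\<close>] by auto
qed simp

definition component_of :: "('v, 'e) multigraph \<Rightarrow> 'v \<Rightarrow> ('v, 'e) multigraph" where
  "component_of G x = induced G {y. \<exists>es. walk G x es y}"

lemma components_eq: "components G = component_of G ` verts G"
  by (simp add: components_def component_of_def)

text \<open>The walk \<open>fs\<close> serves the induction: it records that the current vertex
  \<open>y\<close> is reachable from \<open>x\<close>, so that the next edge stays in the
  component.\<close>

lemma walk_component_of:
  assumes "walk G x fs y" and "walk G y es z"
  shows "walk (component_of G x) y es z"
  using assms
proof (induction es arbitrary: y fs)
  case Nil
  then show ?case by (auto simp: component_of_def induced_def)
next
  case (Cons e es)
  from Cons.prems obtain v where v: "e \<in> edges G" "ends G e = {y, v}" "walk G v es z" "y \<in> verts G"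
    by auto
  have "walk G y [e] v" using v walk_in_verts[OF v(3)] by auto
  then have xv: "walk G x (fs @ [e]) v" using Cons.prems(1) walk_append by metis
  have "walk (component_of G x) v es z" using Cons.IH[OF xv v(3)] .
  moreover have "ends G e \<subseteq> {z. \<exists>es. walk G x es z}"
    unfolding v(2) using xv Cons.prems(1) by blast
  ultimately show ?case
    using v(1,2) Cons.prems(1) unfolding component_of_def induced_def by fastforce
qed

lemma walk_component_of_self: "walk G x es z \<Longrightarrow> walk (component_of G x) x es z"
  using walk_component_of[of G x "[]" x es z] walk_in_verts[of G x es z] by auto

text \<open>Nonempty sets of extended naturals contain their infimum, and the finite bound rules out
  the empty set, whose infimum is infinite.\<close>

lemma distance_le_walk:
  assumes "distance G x y \<le> enat d"
  obtains es where "walk G x es y" "length es \<le> d"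
proof -
  let ?N = "{es. walk G x es y}"
  have "?N \<noteq> {}"
  proof
    assume "?N = {}"
    then have "distance G x y = \<infinity>" unfolding distance_def by (simp add: top_enat_def)
    then show False using assms by simp
  qed
  then obtain es0 where "es0 \<in> ?N" by blast
  then have "distance G x y \<in> (\<lambda>es. enat (length es)) ` ?N"
    unfolding distance_def by (intro wellorder_InfI[of "enat (length es0)"] imageI)
  then show thesis using that assms by auto
qed

lemma distance_le_if_walk: "walk G x es y \<Longrightarrow> distance G x y \<le> enat (length es)"
  unfolding distance_def by (rule INF_lower) simp

text \<open>The odd walk puts \<open>x\<close> and \<open>y\<close> on opposite sides, so a
  connecting walk of length at most 2 consists of a single edge.\<close>

lemma bipartite_diameter_2_adjacent:
  assumes "bipartite C" and "diameter C \<le> enat 2" and "walk C x es y" and "odd (length es)"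
  shows "\<exists>e\<in>edges C. ends C e = {x, y}"
proof -
  have "x \<in> verts C" "y \<in> verts C" using walk_in_verts[OF assms(3)] by auto
  then have "distance C x y \<le> diameter C"
    unfolding diameter_def by (intro SUP_upper2[of "(x, y)"]) auto
  then obtain fs where fs: "walk C x fs y" "length fs \<le> 2"
    using assms(2) by (meson distance_le_walk order_trans)
  obtain S where S: "\<forall>e\<in>edges C. \<exists>x\<in>S. \<exists>y\<in>verts C - S. ends C e = {x, y}"
    using assms(1) unfolding bipartite_def by blast
  have "odd (length fs)"
    using walk_bipartite[OF S assms(3)] walk_bipartite[OF S fs(1)] assms(4) by simp
  then have "length fs = 1" using fs(2) by presburger
  then obtain e where "fs = [e]" by (auto simp: length_Suc_conv)
  then show ?thesis using fs(1) by auto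
qed

lemma girth_le:
  "es \<noteq> [] \<Longrightarrow> distinct_adj es \<Longrightarrow> walk G x es x \<Longrightarrow> girth G \<le> enat (length es)"
  unfolding girth_def by (rule INF_lower) auto

text \<open>Surjectivity of \<open>ends\<close> onto the crossing pairs supplies all edges, and
  injectivity excludes parallel ones.\<close>

locale complete_bipartite =
  fixes G :: "('v, 'e) multigraph" and X Y :: "'v set"
  assumes verts: "verts G = X \<union> Y" and disjoint: "X \<inter> Y = {}"
    and ends: "bij_betw (ends G) (edges G) {{x, y} | x y. x \<in> X \<and> y \<in> Y}"
begin

lemma edge_ends: "e \<in> edges G \<Longrightarrow> \<exists>x\<in>X. \<exists>y\<in>Y. ends G e = {x, y}"
  using bij_betwE[OF ends] by blast

lemma ends_inj: "e \<in> edges G \<Longrightarrow> e' \<in> edges G \<Longrightarrow> ends G e = ends G e' \<Longrightarrow> e = e'"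
  using ends by (auto simp: bij_betw_def inj_on_def)

lemma ex_edge:
  assumes "x \<in> X" "y \<in> Y"
  shows "\<exists>e\<in>edges G. ends G e = {x, y}"
proof -
  have "{x, y} \<in> ends G ` edges G" using ends assms unfolding bij_betw_def by blast
  then show ?thesis by (metis imageE)
qed

lemma walk_1: "x \<in> X \<and> y \<in> Y \<or> x \<in> Y \<and> y \<in> X \<Longrightarrow> \<exists>e. walk G x [e] y"
proof -
  assume xy: "x \<in> X \<and> y \<in> Y \<or> x \<in> Y \<and> y \<in> X"
  then obtain e where "e \<in> edges G" "ends G e = {x, y}"
    using ex_edge[of x y] ex_edge[of y x] by (auto simp: insert_commute)
  then show ?thesis using xy verts by auto
qed

lemma walk_2:
  assumes "X \<noteq> {}" "Y \<noteq> {}" and "x \<in> X \<and> y \<in> X \<or> x \<in> Y \<and> y \<in> Y"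
  shows "\<exists>e f. walk G x [e, f] y"
proof -
  obtain a b where "a \<in> X" "b \<in> Y" using assms by blast
  then obtain z where "x \<in> X \<and> z \<in> Y \<or> x \<in> Y \<and> z \<in> X" "z \<in> X \<and> y \<in> Y \<or> z \<in> Y \<and> y \<in> X"
    using assms(3) that[of a] that[of b] by blast
  then obtain e f where "walk G x [e] z" "walk G z [f] y" using walk_1[of x z] walk_1[of z y] by metis
  then have "walk G x ([e] @ [f]) y" by (rule walk_append)
  then show ?thesis by auto
qed

lemma walk_short:
  assumes "X \<noteq> {}" "Y \<noteq> {}" and "x \<in> verts G" "y \<in> verts G"
  shows "\<exists>es. walk G x es y \<and> length es \<le> 2"
proof -
  consider "x \<in> X \<and> y \<in> Y \<or> x \<in> Y \<and> y \<in> X" | "x \<in> X \<and> y \<in> X \<or> x \<in> Y \<and> y \<in> Y"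
    using assms verts by blast
  then show ?thesis
  proof cases
    case 1
    then obtain e where "walk G x [e] y" using walk_1 by blast
    then show ?thesis by (intro exI[of _ "[e]"]) simp
  next
    case 2
    then obtain e f where "walk G x [e, f] y" using walk_2 assms by blast
    then show ?thesis by (intro exI[of _ "[e, f]"]) simp
  qed
qed

lemma connected_graph:
  assumes "X \<noteq> {}" "Y \<noteq> {}"
  shows "connected_graph G"
  using walk_short[OF assms] assms verts unfolding connected_graph_def by blast

lemma sides: "\<forall>e\<in>edges G. \<exists>x\<in>X. \<exists>y\<in>verts G - X. ends G e = {x, y}"
  using edge_ends verts disjoint by (metis DiffI UnI2 disjoint_iff)

lemma bipartite: "bipartite G"
  unfolding bipartite_def using sides verts by blast

lemma diameter:
  assumes "x \<in> X" "x' \<in> X" "x \<noteq> x'" "Y \<noteq> {}"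
  shows "diameter G = enat 2"
proof (rule antisym)
  show "diameter G \<le> enat 2"
    unfolding diameter_def
  proof (rule SUP_least, clarify)
    fix a b assume "a \<in> verts G" "b \<in> verts G"
    then obtain es where "walk G a es b" "length es \<le> 2"
      using walk_short[of a b] assms by blast
    then show "distance G a b \<le> enat 2"
      using distance_le_if_walk by (metis enat_ord_simps(1) order_trans)
  qed
  \<comment> \<open>Walks between two vertices of one side are even, and not empty since the
    vertices differ.\<close>
  have "enat 2 \<le> distance G x x'"
    unfolding distance_def
  proof (rule INF_greatest, clarify)
    fix es assume w: "walk G x es x'"
    then have "even (length es)" using walk_bipartite[OF sides w] assms by blast
    moreover have "es \<noteq> []" using w assms by auto
    ultimately show "enat 2 \<le> enat (length es)" by (cases es; cases "tl es") auto
  qed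
  also have "\<dots> \<le> diameter G"
    unfolding diameter_def using assms verts by (intro SUP_upper2[of "(x, x')"]) auto
  finally show "enat 2 \<le> diameter G" .
qed

lemma girth:
  assumes "x \<in> X" "x' \<in> X" "x \<noteq> x'" "y \<in> Y" "y' \<in> Y" "y \<noteq> y'"
  shows "girth G = enat 4"
proof (rule antisym)
  obtain e1 where e1: "e1 \<in> edges G" "ends G e1 = {x, y}" using ex_edge assms by blast
  obtain e2 where e2: "e2 \<in> edges G" "ends G e2 = {x', y}" using ex_edge assms by blast
  obtain e3 where e3: "e3 \<in> edges G" "ends G e3 = {x', y'}" using ex_edge assms by blast
  obtain e4 where e4: "e4 \<in> edges G" "ends G e4 = {x, y'}" using ex_edge assms by blast
  have "distinct_adj [e1, e2, e3, e4]"
    using e1(2) e2(2) e3(2) e4(2) assms by (auto simp: doubleton_eq_iff)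
  moreover have "walk G x [e1, e2, e3, e4] x"
    using e1 e2 e3 e4 assms(1,2,4,5) verts by (auto simp: insert_commute)
  ultimately show "girth G \<le> enat 4" using girth_le[of "[e1, e2, e3, e4]" G x] by (simp add: eval_nat_numeral del: walk.simps distinct_adj_Cons_Cons)
  show "enat 4 \<le> girth G"
    unfolding girth_def
  proof (rule INF_greatest, clarify)
    fix es v assume es: "es \<noteq> []" "distinct_adj es" and w: "walk G v es v"
    have ev: "even (length es)" using walk_bipartite[OF sides w] by blast
    \<comment> \<open>A closed walk of length 2 without backtracking would run along two parallel
      edges.\<close>
    have "length es \<noteq> 2"
    proof
      assume "length es = 2"
      then obtain e f where ef: "es = [e, f]" by (auto simp: length_Suc_conv numeral_2_eq_2)
      then have "ends G e = ends G f" "e \<in> edges G" "f \<in> edges G"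
        using w by (auto simp: insert_commute)
      then show False using ends_inj es ef by auto
    qed
    moreover have "length es \<noteq> 0" using es by simp
    ultimately have "4 \<le> length es" using ev by presburger
    then show "enat 4 \<le> enat (length es)" by simp
  qed
qed

lemma degree_ge:
  assumes fin: "finite X" "finite Y" and "x \<in> verts G"
  shows "min (card X) (card Y) \<le> degree G x"
proof -
  \<comment> \<open>An infinite set has \<open>card\<close> 0, so the bound by an injection requires
    a finite edge set.\<close>
  have finE: "finite (edges G)"
  proof -
    have "{{x, y} | x y. x \<in> X \<and> y \<in> Y} = (\<lambda>(x, y). {x, y}) ` (X \<times> Y)" by auto
    then have "finite {{x, y} | x y. x \<in> X \<and> y \<in> Y}" using fin by simp
    then show ?thesis using ends bij_betw_finite by blast
  qed
  have *: "card Z \<le> card {e \<in> edges G. x \<in> ends G e}"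
    if Z: "\<And>z. z \<in> Z \<Longrightarrow> \<exists>e\<in>edges G. ends G e = {x, z}" for Z
  proof -
    obtain f where f: "\<And>z. z \<in> Z \<Longrightarrow> f z \<in> edges G \<and> ends G (f z) = {x, z}"
      using Z by metis
    have "inj_on f Z" by (rule inj_onI) (metis doubleton_eq_iff f)
    moreover have "f ` Z \<subseteq> {e \<in> edges G. x \<in> ends G e}" using f by auto
    ultimately show ?thesis using finE card_inj_on_le[of f Z] by simp
  qed
  have "card Y \<le> card {e \<in> edges G. x \<in> ends G e}" if "x \<in> X"
    using *[of Y] ex_edge[OF that] by simp
  moreover have "card X \<le> card {e \<in> edges G. x \<in> ends G e}" if "x \<in> Y"
    using *[of X] ex_edge[OF _ that] by (simp add: insert_commute)
  ultimately show ?thesis using assms(3) verts unfolding degree_def by fastforce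
qed

end

text \<open>Edges are determined by their endpoints, so a side-preserving bijection \<open>f\<close>
  of the vertices induces one of the edges: pass to endpoint pairs, apply \<open>f\<close>, and
  return through the inverse of \<open>ends\<close>.\<close>

lemma complete_bipartite_iso:
  assumes "complete_bipartite G X Y" and "complete_bipartite H X' Y'"
    and X: "finite X" "finite X'" "card X = card X'" and Y: "finite Y" "finite Y'" "card Y = card Y'"
  shows "graph_iso G H"
proof -
  interpret G: complete_bipartite G X Y by fact
  interpret H: complete_bipartite H X' Y' by fact
  obtain a where a: "bij_betw a X X'" using X finite_same_card_bij by blast
  obtain b where b: "bij_betw b Y Y'" using Y finite_same_card_bij by blast
  define f where "f v = (if v \<in> X then a v else b v)" for v
  have fX: "bij_betw f X X'" using a bij_betw_cong[of X f a] by (simp add: f_def)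
  have fY: "bij_betw f Y Y'" using b bij_betw_cong[of Y f b Y'] G.disjoint unfolding f_def by (smt (verit) disjoint_iff)
  have f: "bij_betw f (verts G) (verts H)"
    unfolding G.verts H.verts using bij_betw_combine[OF fX fY H.disjoint] .
  let ?E = "{{x, y} | x y. x \<in> X \<and> y \<in> Y}" and ?E' = "{{x, y} | x y. x \<in> X' \<and> y \<in> Y'}"
  have "bij_betw ((`) f) ?E ?E'"
  proof (rule bij_betw_imageI)
    have "inj_on ((`) f) (Pow (verts G))"
      using f bij_betw_imp_inj_on inj_on_image_Pow by blast
    then show "inj_on ((`) f) ?E" by (rule inj_on_subset) (auto simp: G.verts)
    have "f ` X = X'" "f ` Y = Y'" using fX fY by (auto simp: bij_betw_def)
    moreover have "?E = (\<lambda>(x, y). {x, y}) ` (X \<times> Y)" "?E' = (\<lambda>(x, y). {x, y}) ` (X' \<times> Y')"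
      by auto
    moreover have "(`) f ` (\<lambda>(x, y). {x, y}) ` (X \<times> Y) = (\<lambda>(x, y). {x, y}) ` (f ` X \<times> f ` Y)"
      by (force simp: image_image)
    ultimately show "(`) f ` ?E = ?E'" by simp
  qed
  then have "bij_betw (inv_into (edges H) (ends H) \<circ> ((`) f \<circ> ends G)) (edges G) (edges H)"
    by (rule bij_betw_trans[OF bij_betw_trans[OF G.ends] bij_betw_inv_into[OF H.ends]])
  moreover have "ends H ((inv_into (edges H) (ends H) \<circ> ((`) f \<circ> ends G)) e) = f ` ends G e"
    if "e \<in> edges G" for e
  proof -
    have "f ` ends G e \<in> ?E'"
      using that G.ends \<open>bij_betw ((`) f) ?E ?E'\<close> by (meson bij_betwE)
    then have "f ` ends G e \<in> ends H ` edges H" using H.ends by (simp add: bij_betw_def)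
    then show ?thesis by (simp add: f_inv_into_f)
  qed
  ultimately show ?thesis using f unfolding graph_iso_def by blast
qed

section \<open>Graphs that split into connected parts\<close>

lemma walk_in_part:
  assumes "\<And>e. e \<in> edges G \<Longrightarrow> ends G e \<inter> P \<noteq> {} \<Longrightarrow> ends G e \<subseteq> P"
    and "walk G x es y" and "x \<in> P"
  shows "y \<in> P"
  using assms(2,3)
proof (induction es arbitrary: x)
  case (Cons e es)
  then obtain z where "e \<in> edges G" "ends G e = {x, z}" "walk G z es y" by auto
  moreover from this have "z \<in> P" using assms(1)[of e] Cons.prems(2) by auto
  ultimately show ?case using Cons.IH by blast
qed simp

lemma walk_induced: "P \<subseteq> verts G \<Longrightarrow> walk (induced G P) x es y \<Longrightarrow> walk G x es y"
  by (induction es arbitrary: x) (auto simp: induced_def)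

text \<open>No edge leaves \<open>P\<close>, so walks from \<open>x\<close> stay inside, and
  connectedness of the induced graph reaches all of \<open>P\<close>.\<close>

lemma component_of_part:
  assumes "\<And>e. e \<in> edges G \<Longrightarrow> ends G e \<inter> P \<noteq> {} \<Longrightarrow> ends G e \<subseteq> P"
    and "P \<subseteq> verts G" and "connected_graph (induced G P)" and "x \<in> P"
  shows "component_of G x = induced G P"
proof -
  have "{y. \<exists>es. walk G x es y} = P"
  proof
    show "{y. \<exists>es. walk G x es y} \<subseteq> P" using walk_in_part[OF assms(1)] assms(4) by blast
    show "P \<subseteq> {y. \<exists>es. walk G x es y}"
      using assms(3,4) walk_induced[OF assms(2)] unfolding connected_graph_def
      by (fastforce simp: induced_def)
  qed
  then show ?thesis by (simp add: component_of_def)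
qed

lemma components_two_parts:
  assumes "verts G = P \<union> Q" and "\<And>e. e \<in> edges G \<Longrightarrow> ends G e \<subseteq> P \<or> ends G e \<subseteq> Q" and "P \<inter> Q = {}"
    and "connected_graph (induced G P)" and "connected_graph (induced G Q)"
  shows "components G = {induced G P, induced G Q}" and "induced G P \<noteq> induced G Q"
proof -
  have "component_of G x = induced G P" if "x \<in> P" for x
    by (rule component_of_part) (use assms that in blast)+
  moreover have "component_of G x = induced G Q" if "x \<in> Q" for x
    by (rule component_of_part) (use assms that in blast)+
  moreover have ne: "P \<noteq> {}" "Q \<noteq> {}"
    using assms(4,5) by (auto simp: connected_graph_def induced_def)
  ultimately show "components G = {induced G P, induced G Q}"
    unfolding components_eq assms(1) image_Un by auto
  show "induced G P \<noteq> induced G Q"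
    using ne assms(3) by (auto simp: induced_def)
qed

section \<open>Residues\<close>

lemma residue_eqI:
  fixes m x y :: int
  assumes "x \<in> {0..<m}" "y \<in> {0..<m}" "m dvd x - y"
  shows "x = y"
  using assms by (metis atLeastLessThan_iff mod_eq_dvd_iff mod_pos_pos_trivial)

text \<open>Each pair \<open>2 * j\<close>, \<open>2 * j + 1\<close> meets the class exactly
  once.\<close>

lemma card_parity_class:
  assumes "0 \<le> m"
  shows "card {x \<in> {0..<2 * m}. even (x - c :: int)} = nat m"
proof -
  have "bij_betw (\<lambda>j. 2 * j + c mod 2) {0..<m} {x \<in> {0..<2 * m}. even (x - c)}"
    by (rule bij_betw_byWitness[where f' = "\<lambda>x. x div 2"]) (auto; presburger)+
  then show ?thesis using bij_betw_same_card by fastforce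
qed

text \<open>Translation by \<open>a + h\<close> permutes \<open>D\<close>, so it does not change the sum over \<open>D\<close>.\<close>

lemma dvd_card_mult_if_triple_sums_closed:
  fixes D :: "int set"
  assumes D: "D \<subseteq> {0..<m}" and closed: "\<And>a b c. a \<in> D \<Longrightarrow> b \<in> D \<Longrightarrow> c \<in> D \<Longrightarrow> (a + b + c) mod m \<in> D"
    and "a \<in> D" "h \<in> D"
  shows "m dvd int (card D) * (a + h)"
proof -
  define f where "f x = (x + a + h) mod m" for x
  have fin: "finite D" using D finite_subset by blast
  have inj: "inj_on f D"
  proof (rule inj_onI)
    fix x y assume xy: "x \<in> D" "y \<in> D" "f x = f y"
    then have "m dvd x - y" by (simp add: f_def mod_eq_dvd_iff)
    then show "x = y" using residue_eqI[of x m y] D xy(1,2) by blast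
  qed
  have "f ` D = D"
    using closed assms(3,4) by (intro endo_inj_surj[OF fin _ inj]) (auto simp: f_def)
  then have "(\<Sum>x\<in>D. x) mod m = (\<Sum>x\<in>D. f x) mod m"
    using sum.reindex[OF inj, of id] by (simp add: o_def)
  also have "\<dots> = (\<Sum>x\<in>D. x + (a + h)) mod m"
    by (simp add: f_def mod_sum_eq add.assoc)
  also have "\<dots> = ((\<Sum>x\<in>D. x) + int (card D) * (a + h)) mod m"
    by (simp add: sum.distrib)
  finally have "((\<Sum>x\<in>D. x) + int (card D) * (a + h)) mod m = (\<Sum>x\<in>D. x) mod m" ..
  then show ?thesis by (simp add: mod_eq_dvd_iff)
qed

section \<open>The relator as a periodic sequence\<close>

locale cyclic_relator =
  fixes n :: nat and u w :: "int word"
  assumes n_ge_2: "n \<ge> 2" and even_n: "even n"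
    and u: "u \<in> carrier (free_group (cyc_gens n))" and u_nonempty: "u \<noteq> []"
    and w: "w = u \<otimes>\<^bsub>free_group (cyc_gens n)\<^esub> word_inv ((shift n ^^ (n div 2)) u)"
    and alternating_w: "alternating w"
    and not_power: "\<not> proper_power (free_group (cyc_gens n)) w"
begin

definition h :: int where "h = int n div 2"

definition L :: int where "L = int (length u)"

text \<open>The \<open>c\<close>-th power of \<theta> on letters, for any integer
  \<open>c\<close>.\<close>

definition shift_letter :: "int \<Rightarrow> int letter \<Rightarrow> int letter" where
  "shift_letter c = map_letter (\<lambda>x. (x + c) mod int n)"

text \<open>The two-sided periodic extension of \<open>w\<close>, whose length is
  \<open>2 * L\<close>; integer positions make its reflection symmetry a single formula.\<close>

definition W :: "int \<Rightarrow> int letter" where "W p = w ! nat (p mod (2 * L))"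

definition V :: "int \<Rightarrow> int" where "V p = subscript (W p)"

lemma n_eq: "int n = 2 * h"
  using even_n unfolding h_def by auto

lemma h_pos: "h > 0"
  using n_eq n_ge_2 by linarith

lemma L_pos: "L > 0"
  using u_nonempty by (simp add: L_def)

lemma subscript_shift_letter [simp]: "subscript (shift_letter c x) = (subscript x + c) mod int n"
  by (cases x) (auto simp: shift_letter_def)

lemma positive_shift_letter [simp]: "positive (shift_letter c x) \<longleftrightarrow> positive x"
  by (cases x) (auto simp: shift_letter_def)

lemma letter_inv_shift_letter: "letter_inv (shift_letter c x) = shift_letter c (letter_inv x)"
  by (cases x) (auto simp: shift_letter_def)

lemma shift_letter_shift_letter [simp]: "shift_letter a (shift_letter b x) = shift_letter (b + a) x"
  by (cases x) (auto simp: shift_letter_def mod_simps add_ac)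

lemma shift_letter_cong: "int n dvd a - b \<Longrightarrow> shift_letter a = shift_letter b"
  unfolding shift_letter_def by (metis mod_add_right_eq mod_eq_dvd_iff)

lemma shift_letter_0: "subscript x \<in> cyc_gens n \<Longrightarrow> shift_letter 0 x = x"
  by (cases x) (auto simp: shift_letter_def cyc_gens_def)

lemma shift_letter_eq_iff:
  "shift_letter a x = shift_letter b y \<longleftrightarrow> positive x = positive y \<and> int n dvd (subscript x + a) - (subscript y + b)"
  using letter_eq_iff[of "shift_letter a x" "shift_letter b y"] by (simp add: mod_eq_dvd_iff)

lemma shift_pow:
  assumes "\<And>x. x \<in> set v \<Longrightarrow> subscript x \<in> cyc_gens n"
  shows "(shift n ^^ i) v = map (shift_letter (int i)) v"
proof (induction i)
  case 0
  then show ?case using assms by (simp add: shift_letter_0 map_idI)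
next
  case (Suc i)
  then show ?case by (simp add: shift_def shift_letter_def[symmetric] add.commute)
qed

lemma u_subscripts: "x \<in> set u \<Longrightarrow> subscript x \<in> cyc_gens n"
  using u unfolding free_group_def by (auto simp: letters_over_iff)

lemma u_subscripts_nth: "i < length u \<Longrightarrow> subscript (u ! i) \<in> cyc_gens n"
  using u_subscripts by simp

text \<open>Each half inherits reducedness from \<open>u\<close>. At the junction the last letter of
  \<open>u\<close> meets the inverse of its own shift by \<open>h\<close>, and \<open>n\<close> does
  not divide \<open>h\<close>.\<close>

lemma reduced_append_inv_shift: "reduced (u @ word_inv (map (shift_letter h) u))"
proof -
  let ?v = "word_inv (map (shift_letter h) u)"
  let ?l = "length u"
  have ru: "\<And>i. Suc i < ?l \<Longrightarrow> u ! Suc i \<noteq> letter_inv (u ! i)"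
    using u by (auto simp: free_group_def reduced_iff_nth)
  have v: "?v ! j = letter_inv (shift_letter h (u ! (?l - 1 - j)))" if "j < ?l" for j
    using that by (subst nth_word_inv) auto
  show ?thesis
    unfolding reduced_iff_nth
  proof (intro allI impI)
    fix i assume i: "Suc i < length (u @ ?v)"
    consider "Suc i < ?l" | "Suc i = ?l" | "Suc i > ?l" by linarith
    then show "(u @ ?v) ! Suc i \<noteq> letter_inv ((u @ ?v) ! i)"
    proof cases
      case 1
      then show ?thesis using ru by (simp add: nth_append)
    next
      case 2
      have i2: "?l - 1 = i" "i < ?l" using 2 by auto
      have "\<not> int n dvd h" using n_eq h_pos zdvd_not_zless by auto
      then have "shift_letter h (u ! i) \<noteq> shift_letter 0 (u ! i)" by (simp add: shift_letter_eq_iff)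
      moreover have "?v ! 0 = letter_inv (shift_letter h (u ! i))" using v[of 0] i2 u_nonempty by simp
      ultimately show ?thesis using i2 2 u_subscripts_nth[of i] by (simp add: nth_append shift_letter_0)
    next
      case 3
      \<comment> \<open>The second half reads \<open>u\<close> backwards, so positions
        \<open>i\<close> and \<open>Suc i\<close> come from positions \<open>Suc j\<close> and
        \<open>j\<close> of \<open>u\<close>.\<close>
      define j where "j = 2 * ?l - 2 - i"
      have j: "Suc j < ?l" "i - ?l < ?l" "Suc i - ?l < ?l" "?l - 1 - (i - ?l) = Suc j"
        "?l - 1 - (Suc i - ?l) = j"
        using 3 i by (auto simp: j_def)
      have "\<not> int n dvd subscript (u ! Suc j) - subscript (u ! j)" if "subscript (u ! Suc j) \<noteq> subscript (u ! j)"
        using residue_eqI that u_subscripts_nth[of j] u_subscripts_nth[of "Suc j"] j(1)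
        unfolding cyc_gens_def by auto
      then have "shift_letter h (u ! Suc j) \<noteq> shift_letter h (letter_inv (u ! j))"
        using ru[OF j(1)] unfolding shift_letter_eq_iff letter_eq_iff[of "u ! Suc j"] by auto
      then show ?thesis using 3 v[OF j(2)] v[OF j(3)] j
        by (simp add: nth_append letter_inv_shift_letter[symmetric])
    qed
  qed
qed

lemma w_eq: "w = u @ word_inv (map (shift_letter h) u)"
proof -
  have "(shift n ^^ (n div 2)) u = map (shift_letter h) u"
    using shift_pow[OF u_subscripts] by (simp add: h_def zdiv_int)
  then show ?thesis
    unfolding w using free_reduce_reduced[OF reduced_append_inv_shift] by (simp add: free_group_def)
qed

lemma reduced_w: "reduced w"
  using reduced_append_inv_shift w_eq by simp

lemma length_w: "length w = 2 * length u"
  by (simp add: w_eq)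

lemma length_w_int: "int (length w) = 2 * L"
  by (simp add: length_w L_def)

section \<open>The periodic sequence and its reflection\<close>

lemma W_cong: "2 * L dvd p - q \<Longrightarrow> W p = W q"
  unfolding W_def mod_eq_dvd_iff[symmetric] by simp

lemma W_nth: "i < length w \<Longrightarrow> W (int i) = w ! i"
  using length_w_int by (simp add: W_def)

lemma W_nth_u: "i < length u \<Longrightarrow> W (int i) = u ! i"
  using W_nth[of i] by (simp add: w_eq nth_append)

lemma W_cases:
  obtains i where "i < length w" "2 * L dvd p - int i" "W p = w ! i"
proof
  let ?i = "nat (p mod (2 * L))"
  have *: "0 \<le> p mod (2 * L)" "p mod (2 * L) < 2 * L" using L_pos by simp_all
  then show "?i < length w" using length_w_int by linarith
  show "2 * L dvd p - int ?i" using * by (simp add: dvd_minus_mod)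
  show "W p = w ! ?i" by (simp add: W_def)
qed

lemma w_subscripts: "x \<in> set w \<Longrightarrow> subscript x \<in> cyc_gens n"
  using u_subscripts n_ge_2 by (auto simp: w_eq word_inv_def cyc_gens_def)

lemma V_range: "V p \<in> {0..<int n}"
  using w_subscripts unfolding V_def cyc_gens_def by (metis W_cases nth_mem)

lemma shift_letter_0_W: "shift_letter 0 (W p) = W p"
  using V_range shift_letter_0 by (simp add: V_def cyc_gens_def)

text \<open>Inversion reverses \<open>u\<close>, so \<open>p\<close> and \<open>- 1 - p\<close> fall
  into opposite halves, at the same letter of \<open>u\<close>. One formula serves both halves
  because a shift by \<open>2 * h\<close> is trivial.\<close>

lemma W_reflect: "W (- 1 - p) = letter_inv (shift_letter h (W p))"
proof -
  obtain i where i: "i < length w" "2 * L dvd p - int i" "W p = w ! i" by (rule W_cases)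
  let ?j = "length w - 1 - i"
  have j: "?j < length w" using i(1) by simp
  have "- 1 - p - int ?j = - (p - int i) - 2 * L"
    using i(1) length_w_int by (simp add: of_nat_diff)
  then have "2 * L dvd - 1 - p - int ?j"
    using i(2) by (metis dvd_minus_iff dvd_diff dvd_refl)
  then have Wj: "W (- 1 - p) = w ! ?j" using W_cong W_nth[OF j] by metis
  show ?thesis
  proof (cases "i < length u")
    case True
    then have "\<not> ?j < length u" "?j - length u < length u" "length u - 1 - (?j - length u) = i"
      using length_w by auto
    then show ?thesis unfolding Wj i(3) using True
      unfolding w_eq by (simp add: nth_append nth_word_inv del: length_append)
  next
    case False
    then have j': "?j < length u" using i(1) length_w by simp
    have "length u - 1 - (i - length u) = ?j" "i - length u < length u"
      using False i(1) length_w by auto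
    then have "w ! i = letter_inv (shift_letter h (u ! ?j))"
      using False unfolding w_eq by (simp add: nth_append nth_word_inv)
    moreover have "shift_letter (h + h) (u ! ?j) = u ! ?j"
      using shift_letter_cong[of "h + h" 0] n_eq shift_letter_0[OF u_subscripts_nth[OF j']] by simp
    moreover have "w ! ?j = u ! ?j" using j' by (simp add: w_eq nth_append)
    ultimately show ?thesis unfolding Wj i(3) by (simp add: letter_inv_shift_letter)
  qed
qed

lemma V_reflect: "int n dvd V (- 1 - p) - (V p + h)"
  by (simp add: V_def W_reflect letter_inv_shift_letter mod_eq_dvd_iff[symmetric])

text \<open>Away from the wrap-around both facts come from \<open>w\<close>. There, the last letter
  is the inverse of the shift by \<open>h\<close> of the first, so it has the opposite sign and does
  not cancel.\<close>

lemma W_Suc: "positive (W (p + 1)) \<longleftrightarrow> \<not> positive (W p)" "W (p + 1) \<noteq> letter_inv (W p)"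
proof -
  obtain i where i: "i < length w" "2 * L dvd p - int i" "W p = w ! i" by (rule W_cases)
  have "(positive (W (p + 1)) \<longleftrightarrow> \<not> positive (W p)) \<and> W (p + 1) \<noteq> letter_inv (W p)"
  proof (cases "Suc i < length w")
    case True
    have "W (p + 1) = w ! Suc i"
      using W_cong[of "p + 1" "int (Suc i)"] W_nth[OF True] i(2) by (simp add: algebra_simps)
    moreover have "w ! Suc i \<noteq> letter_inv (w ! i)"
      using True reduced_w unfolding reduced_iff_nth by blast
    moreover have "positive (w ! Suc i) \<longleftrightarrow> \<not> positive (w ! i)"
      using alternating_nth[OF alternating_w True] .
    ultimately show ?thesis unfolding i(3) by simp
  next
    case False
    then have "int i = 2 * L - 1" using i(1) length_w_int by linarith
    then have "p - (- 1) = (p - int i) + 2 * L" by simp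
    then have "2 * L dvd p - (- 1)" using i(2) by (metis dvd_add dvd_refl)
    then have "W p = W (- 1 - 0)" "W (p + 1) = W 0"
      using W_cong[of p "-1"] W_cong[of "p + 1" 0] by (simp_all add: algebra_simps)
    then have *: "W p = letter_inv (shift_letter h (W (p + 1)))" using W_reflect by metis
    have "\<not> int n dvd h" using n_eq h_pos zdvd_not_zless by auto
    then have "shift_letter h (W (p + 1)) \<noteq> shift_letter 0 (W (p + 1))" by (simp add: shift_letter_eq_iff)
    then have "W (p + 1) \<noteq> letter_inv (W p)" unfolding * by (simp add: shift_letter_0_W)
    moreover have "positive (W (p + 1)) \<longleftrightarrow> \<not> positive (W p)"
      unfolding * by simp
    ultimately show ?thesis by blast
  qed
  then show "positive (W (p + 1)) \<longleftrightarrow> \<not> positive (W p)" "W (p + 1) \<noteq> letter_inv (W p)" by blast+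
qed

lemma V_Suc_neq: "V (p + 1) \<noteq> V p"
  using W_Suc[of p] letter_eq_iff[of "W (p + 1)" "letter_inv (W p)"]
  by (auto simp: V_def)

lemma positive_W: "positive (W p) \<longleftrightarrow> (even p \<longleftrightarrow> positive (W 0))"
proof (induction p rule: int_induct[where k = 0])
  case (step1 i)
  then show ?case using W_Suc(1)[of i] by simp blast
next
  case (step2 i)
  then show ?case using W_Suc(1)[of "i - 1"] by simp blast
qed simp

text \<open>The cyclic permutation, starting at position \<open>p\<close>, of the image of
  \<open>w\<close> under the \<open>i\<close>-th power of \<theta>.\<close>

definition T :: "int \<Rightarrow> int \<Rightarrow> int word" where
  "T p i = map (\<lambda>s. shift_letter i (W (p + int s))) [0..<length w]"

lemma length_T [simp]: "length (T p i) = length w"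
  by (simp add: T_def)

lemma T_nth: "s < length w \<Longrightarrow> T p i ! s = shift_letter i (W (p + int s))"
  by (simp add: T_def)

lemma length_w_ge_2: "length w \<ge> 2"
  using length_w_int L_pos by linarith

lemma hd_T [simp]: "hd (T p i) = shift_letter i (W p)"
proof -
  have "T p i \<noteq> []" using length_T[of p i] length_w_ge_2 by force
  moreover have "0 < length w" using length_w_ge_2 by linarith
  ultimately show ?thesis using T_nth[of 0 p i] by (simp add: hd_conv_nth)
qed

lemma T_cong: "2 * L dvd p - q \<Longrightarrow> int n dvd i - j \<Longrightarrow> T p i = T q j"
proof -
  assume "2 * L dvd p - q" "int n dvd i - j"
  then have "W (p + int s) = W (q + int s)" "shift_letter i = shift_letter j" for s
    using W_cong[of "p + int s" "q + int s"] shift_letter_cong by simp_all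
  then show ?thesis by (simp add: T_def)
qed

lemma T_eq_D:
  assumes "T p i = T q j"
  shows "shift_letter i (W (p + s)) = shift_letter j (W (q + s))"
proof -
  define t where "t = nat (s mod (2 * L))"
  have s: "0 \<le> s mod (2 * L)" "s mod (2 * L) < 2 * L" using L_pos by simp_all
  then have t: "t < length w" "int t = s mod (2 * L)" using length_w_int by (auto simp: t_def)
  have "W (p + int t) = W (p + s)" for p
    using t(2) by (intro W_cong) (simp add: mod_eq_dvd_iff[symmetric])
  then show ?thesis using T_nth[OF t(1), of p i] T_nth[OF t(1), of q j] assms by simp
qed

text \<open>The reflection \<open>p \<mapsto> - 1 - p\<close> turns a translation symmetry with offset \<open>c\<close> into the relation
  \<open>2 * (c + h) = 0\<close>, which leaves \<open>c = 0\<close>, where the word would be a proper power, and \<open>c = h\<close>,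
  where the composed reflection would fix the centre of a cancelling pair.\<close>

lemma T_eq_iff: "T p i = T q j \<longleftrightarrow> 2 * L dvd p - q \<and> int n dvd i - j"
proof
  assume eq: "T p i = T q j"
  define r where "r = q - p"
  define c where "c = i - j"
  have shift: "shift_letter i (W s) = shift_letter j (W (s + r))" for s
    using T_eq_D[OF eq, of "s - p"] by (simp add: r_def algebra_simps)
  have pos: "positive (W s) \<longleftrightarrow> positive (W (s + r))" for s
    using shift[of s] by (metis positive_shift_letter)
  then have even_r: "even r" using positive_W by (metis add_0 even_zero)
  have V: "int n dvd V (s + r) - (V s + c)" for s
  proof -
    have "int n dvd - ((V s + i) - (V (s + r) + j))"
      using shift[of s] unfolding shift_letter_eq_iff V_def[symmetric] by (simp only: dvd_minus_iff)
    moreover have "- ((V s + i) - (V (s + r) + j)) = V (s + r) - (V s + c)"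
      by (simp add: c_def)
    ultimately show ?thesis by (simp only:)
  qed
  have refl: "int n dvd V (- 1 - s - r) - (V s + c + h)" for s
    using dvd_add[OF V_reflect[of "s + r"] V[of s]] by (simp add: algebra_simps)
  \<comment> \<open>The map from \<open>s\<close> to \<open>- 1 - s - r\<close> is an involution;
    \<open>refl\<close> at 0 and at the image of 0 leads back to 0 with the offset
    \<open>c + h\<close> taken twice.\<close>
  have "int n dvd - (2 * (c + h))"
    using dvd_add[OF refl[of "- 1 - 0 - r"] refl[of 0]] by (simp add: algebra_simps)
  then have "int n dvd 2 * (c + h)" by (simp only: dvd_minus_iff)
  then have "h dvd c + h" by (simp add: n_eq)
  then have "h dvd c" by simp
  then obtain m where m: "c = h * m" by blast
  have "even m"
  proof (rule ccontr)
    assume "odd m"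
    then have "int n dvd c + h" by (auto simp: m n_eq algebra_simps elim!: oddE)
    \<comment> \<open>The composed reflection exchanges this \<open>s\<close> with
      \<open>s + 1\<close>; the halving is exact because \<open>r\<close> is even. With
      \<open>c + h\<close> divisible by \<open>n\<close>, two neighbouring subscripts would
      coincide.\<close>
    define s where "s = - (r + 2) div 2"
    have "2 * s = - (r + 2)" using even_r by (simp add: s_def)
    then have "- 1 - s - r = s + 1" by simp
    then have "int n dvd V (s + 1) - (V s + c + h)" using refl[of s] by (simp only:)
    then have "int n dvd (V (s + 1) - (V s + c + h)) + (c + h)"
      using \<open>int n dvd c + h\<close> dvd_add by blast
    then have "int n dvd V (s + 1) - V s" by simp
    then show False
      using residue_eqI[OF V_range V_range] V_Suc_neq by blast
  qed
  then have c: "int n dvd c" by (auto simp: m n_eq)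
  have W: "W (s + r) = W s" for s
  proof -
    have "int n dvd (V (s + r) - (V s + c)) + c" using V[of s] c dvd_add by blast
    then have "int n dvd V (s + r) - V s" by simp
    then have "V (s + r) = V s"
      by (rule residue_eqI[OF V_range V_range])
    then show ?thesis using pos[of s] letter_eq_iff by (auto simp: V_def)
  qed
  have "2 * L dvd r"
  proof (rule ccontr)
    assume not_dvd: "\<not> 2 * L dvd r"
    define t where "t = nat (r mod (2 * L))"
    have s: "0 \<le> r mod (2 * L)" "r mod (2 * L) < 2 * L" using L_pos by simp_all
    then have t: "int t = r mod (2 * L)" "t < length w" using length_w_int by (auto simp: t_def)
    have "\<not> length w dvd t"
      using not_dvd t nat_dvd_not_less[of t "length w"] by (auto simp: dvd_eq_mod_eq_0)
    moreover have "rotate t w = w"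
    proof (rule nth_equalityI)
      fix x assume x: "x < length (rotate t w)"
      then have "rotate t w ! x = w ! ((t + x) mod length w)" by (simp add: nth_rotate)
      also have "\<dots> = W (int ((t + x) mod length w))"
        using x by (intro W_nth[symmetric] mod_less_divisor) auto
      also have "\<dots> = W (int x + r)"
      proof (rule W_cong)
        have "int ((t + x) mod length w) = (r mod (2 * L) + int x) mod (2 * L)"
          unfolding t(1)[symmetric] by (simp add: of_nat_mod length_w_int)
        also have "\<dots> = (int x + r) mod (2 * L)"
          by (metis mod_add_left_eq add.commute)
        finally show "2 * L dvd int ((t + x) mod length w) - (int x + r)"
          unfolding mod_eq_dvd_iff[symmetric] by (simp only: mod_mod_trivial)
      qed
      also have "\<dots> = w ! x" using x W W_nth by simp
      finally show "rotate t w ! x = w ! x" .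
    qed simp
    moreover have "w \<in> carrier (free_group (cyc_gens n))"
      using reduced_w w_subscripts by (auto simp: free_group_def letters_over_iff)
    moreover have "w \<noteq> []" using length_w_ge_2 by auto
    ultimately show False using proper_power_if_rotate_eq not_power by blast
  qed
  then show "2 * L dvd p - q \<and> int n dvd i - j"
    using c unfolding r_def c_def by (simp add: dvd_diff_commute)
qed (use T_cong in blast)

lemma T_0_nat: "(shift n ^^ i) w = T 0 (int i)"
proof -
  have "map (shift_letter (int i)) w = T 0 (int i)"
    by (rule nth_equalityI) (auto simp: T_nth W_nth)
  then show ?thesis using shift_pow[OF w_subscripts] by simp
qed

lemma rotate_T: "rotate r (T p i) = T (p + int r) i"
proof (rule nth_equalityI)
  fix s assume "s < length (rotate r (T p i))"
  then have s: "s < length w" by simp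
  have "2 * L dvd (p + int ((r + s) mod length w)) - (p + int r + int s)"
    by (simp add: mod_eq_dvd_iff[symmetric] of_nat_mod length_w_int mod_simps algebra_simps)
  then have "W (p + int ((r + s) mod length w)) = W (p + int r + int s)" by (rule W_cong)
  moreover have "(r + s) mod length w < length w" using s by (intro mod_less_divisor) linarith
  ultimately show "rotate r (T p i) ! s = T (p + int r) i ! s"
    using s by (simp add: nth_rotate T_nth)
qed simp

text \<open>This is \<open>W_reflect\<close> applied letter by letter. For \<open>p = 0\<close> it
  makes the inverse of a relator a relator, so inverses add nothing to the cyclic
  permutations.\<close>

lemma word_inv_T: "word_inv (T p i) = T (- p) (i + h)"
proof (rule nth_equalityI)
  fix s assume "s < length (word_inv (T p i))"
  then have s: "s < length w" by simp
  let ?q = "p + int (length w - 1 - s)"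
  have "word_inv (T p i) ! s = letter_inv (shift_letter i (W ?q))"
    using s by (simp add: nth_word_inv T_nth)
  also have "\<dots> = shift_letter (i + h) (W (- 1 - ?q))"
    using shift_letter_cong[of "h + (i + h)" i] n_eq
    by (simp add: W_reflect letter_inv_shift_letter add_ac)
  also have "W (- 1 - ?q) = W (- p + int s)"
    using s length_w_int by (intro W_cong) (simp add: of_nat_diff)
  finally show "word_inv (T p i) ! s = T (- p) (i + h) ! s" using s by (simp add: T_nth)
qed simp

section \<open>The symmetrized relators\<close>

abbreviation relators :: "int word set" where
  "relators \<equiv> {(shift n ^^ i) w | i. i < n}"

lemma relators_eq: "relators = range (T 0)"
proof (intro equalityI subsetI)
  fix v assume "v \<in> range (T 0)"
  then obtain i where "v = T 0 i" by blast
  also have "T 0 i = T 0 (int (nat (i mod int n)))"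
    using n_ge_2 by (intro T_cong) (simp_all add: dvd_minus_mod)
  finally have "v = (shift n ^^ nat (i mod int n)) w" by (simp only: T_0_nat)
  moreover have "nat (i mod int n) < n" using n_ge_2 by (simp add: nat_less_iff)
  ultimately show "v \<in> relators" by blast
qed (auto simp: T_0_nat)

lemma symmetrized_relators: "symmetrized relators = {T p i | p i. True}"
proof (intro equalityI subsetI)
  fix v assume "v \<in> symmetrized relators"
  then obtain r i where "v = rotate r (T 0 i) \<or> v = rotate r (word_inv (T 0 i))"
    unfolding symmetrized_def relators_eq by blast
  then show "v \<in> {T p i | p i. True}" unfolding word_inv_T rotate_T by blast
next
  fix v assume "v \<in> {T p i | p i. True}"
  then obtain p i where "v = T p i" by blast
  also have "\<dots> = T (0 + int (nat (p mod (2 * L)))) i"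
    using L_pos by (intro T_cong) (simp_all add: dvd_minus_mod)
  also have "\<dots> = rotate (nat (p mod (2 * L))) (T 0 i)" by (simp only: rotate_T)
  finally show "v \<in> symmetrized relators" unfolding symmetrized_def relators_eq by blast
qed

section \<open>The star graph\<close>

text \<open>The edge carried by \<open>T p i\<close>. The second word is the inverse of
  \<open>T p i\<close> rotated back by two letters, which is the word identified with it.\<close>

definition E :: "int \<Rightarrow> int \<Rightarrow> int word set" where
  "E p i = {T p i, T (- 2 - p) (i + h)}"

lemma E_reflect: "E (- 2 - p) (i + h) = E p i"
proof -
  have "T (- 2 - (- 2 - p)) (i + h + h) = T p i"
    using n_eq by (intro T_cong) simp_all
  then show ?thesis unfolding E_def by auto
qed

abbreviation star :: "(int letter, int word set) multigraph" where
  "star \<equiv> star_graph (cyclic_presentation n w)"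

lemma edges_star: "edges star = {E p i | p i. True}"
proof -
  have split: "y # letter_inv x # word_inv z = T (- 2 - p) (i + h)"
    if "x # letter_inv y # z = T p i" for x y z p i
  proof -
    have len: "length z = length w - 2" using arg_cong[OF that, of length] by simp
    \<comment> \<open>The inverse word ends in \<open>y\<close>, \<open>letter_inv x\<close>;
      bringing these two letters to the front is a rotation by -2 modulo the period.\<close>
    have "y # letter_inv x # word_inv z = rotate (length (word_inv z)) (word_inv z @ [y, letter_inv x])"
      using rotate_append[of "word_inv z" "[y, letter_inv x]"] by simp
    also have "word_inv z @ [y, letter_inv x] = word_inv (x # letter_inv y # z)"
      by (simp add: word_inv_def)
    also have "rotate (length (word_inv z)) \<dots> = T (- p + int (length w - 2)) (i + h)"
      unfolding that word_inv_T rotate_T by (simp add: len)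
    also have "\<dots> = T (- 2 - p) (i + h)"
      using length_w_ge_2 length_w_int by (intro T_cong) (simp_all add: of_nat_diff)
    finally show ?thesis .
  qed
  have "\<exists>x y z. T p i = x # letter_inv y # z" for p i
  proof -
    obtain x y z where "T p i = x # y # z"
      using length_w_ge_2 by (cases "T p i"; cases "tl (T p i)") (use length_T[of p i] in auto)
    then show ?thesis by (metis letter_inv_letter_inv)
  qed
  then show ?thesis
    unfolding cyclic_presentation_def star_graph.simps multigraph.simps symmetrized_relators E_def
    using split by (auto 0 4) (metis split)+
qed

lemma verts_star: "verts star = letters_over (cyc_gens n)"
  by (simp add: cyclic_presentation_def)

lemma ends_star_hd: "ends star e = hd ` e"
  by (simp add: cyclic_presentation_def)

text \<open>The sign of \<open>W p\<close> depends on the parity of \<open>p\<close> only, so the parity of \<open>c\<close> selects the part.\<close>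

definition vertex :: "int \<Rightarrow> int \<Rightarrow> int letter" where
  "vertex c a = (if positive (W c) then Pos a else Neg a)"

lemma vertex_eq_iff: "vertex c a = vertex d b \<longleftrightarrow> a = b \<and> even (c - d)"
  using positive_W[of c] positive_W[of d] by (auto simp: vertex_def)

lemma subscript_vertex [simp]: "subscript (vertex c a) = a"
  by (simp add: vertex_def)

lemma letter_eq_vertex: "x = vertex 0 (subscript x) \<or> x = vertex 1 (subscript x)"
  using positive_W[of 1] by (cases x) (auto simp: vertex_def)

text \<open>For fixed \<open>p\<close>, all edges \<open>E p i\<close> join vertices whose
  subscripts differ by this residue: it is a generator of the Cayley graph.\<close>

definition step :: "int \<Rightarrow> int" where "step p = (V (p + 1) - V p) mod int n"

lemma shift_letter_W: "shift_letter i (W p) = vertex p ((V p + i) mod int n)"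
  by (simp add: letter_eq_iff vertex_def V_def add.commute)

lemma shift_letter_W_Suc: "letter_inv (shift_letter i (W (p + 1))) = vertex p ((V p + i + step p) mod int n)"
  using W_Suc(1)[of p] by (simp add: letter_eq_iff vertex_def V_def step_def mod_simps add.commute)

text \<open>The partner word starts with the inverse of the second letter of \<open>T p i\<close>;
  this gives the other endpoint of the edge.\<close>

lemma shift_letter_W_reflect: "shift_letter (i + h) (W (- 2 - p)) = vertex p ((V p + i + step p) mod int n)"
proof -
  have "- 2 - p = - 1 - (p + 1)" by simp
  then have "shift_letter (i + h) (W (- 2 - p)) = shift_letter (i + h) (W (- 1 - (p + 1)))" by (simp only:)
  also have "\<dots> = letter_inv (shift_letter i (W (p + 1)))"
    using shift_letter_cong[of "h + (i + h)" i] n_eq by (simp only: W_reflect letter_inv_shift_letter shift_letter_shift_letter) simp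
  finally show ?thesis by (simp only: shift_letter_W_Suc)
qed

lemma ends_E: "ends star (E p i) = {vertex p ((V p + i) mod int n), vertex p ((V p + i + step p) mod int n)}"
  unfolding ends_star_hd E_def using shift_letter_W_reflect[of i p] by (simp add: shift_letter_W del: mod_add_left_eq)

lemma step_range: "step p \<in> {0..<int n}"
  using n_ge_2 by (simp add: step_def)

lemma step_mod [simp]: "step p mod int n = step p"
  by (simp add: step_def)

lemma step_nonzero: "step p \<noteq> 0"
  using residue_eqI[OF V_range V_range] V_Suc_neq by (auto simp: step_def mod_eq_0_iff_dvd)

text \<open>Reflection reverses the order of the neighbours \<open>p\<close> and
  \<open>p + 1\<close>, and the added \<open>h\<close> cancels in the difference.\<close>

lemma step_reflect: "step (- 2 - p) = (- step p) mod int n"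
proof -
  have "int n dvd (V (- 1 - p) - (V p + h)) - (V (- 1 - (p + 1)) - (V (p + 1) + h))"
    using V_reflect dvd_diff by blast
  moreover have "(V (- 1 - p) - (V p + h)) - (V (- 1 - (p + 1)) - (V (p + 1) + h)) =
      (V (- 1 - p) - V (- 1 - (p + 1))) - - (V (p + 1) - V p)" by simp
  ultimately have "(V (- 1 - p) - V (- 1 - (p + 1))) mod int n = (- step p) mod int n"
    unfolding step_def mod_minus_eq mod_eq_dvd_iff by (simp only:)
  moreover have "- 1 - (p + 1) = - 2 - p" "- 1 - p = - 2 - p + 1" by simp_all
  ultimately show ?thesis unfolding step_def[of "- 2 - p"] by (simp only:)
qed

lemma step_cong: "2 * L dvd p - q \<Longrightarrow> step p = step q"
  using W_cong[of p q] W_cong[of "p + 1" "q + 1"] by (simp add: step_def V_def)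

lemma step_eq_h: "int n dvd V (p + 1) - (V p + h) \<Longrightarrow> step p = h"
  using n_eq h_pos unfolding step_def
  by (metis add_diff_cancel_left' diff_diff_eq less_add_same_cancel1 linorder_not_less mod_eq_dvd_iff
      mod_pos_pos_trivial mult_2 nat_less_le order_less_imp_le)

text \<open>The positions -1, 0 and \<open>L - 1\<close>, \<open>L\<close> are the junctions of the
  two halves. Modulo the period the reflection swaps each pair, so its members differ by
  \<open>h\<close>.\<close>

lemma step_minus_1: "step (- 1) = h"
  using V_reflect[of "- 1"] by (intro step_eq_h) simp

lemma step_L: "step (L - 1) = h"
proof (rule step_eq_h)
  have "V (- 1 - L) = V (L - 1)"
    using W_cong[of "- 1 - L" "L - 1"] by (simp add: V_def)
  then show "int n dvd V (L - 1 + 1) - (V (L - 1) + h)"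
    using V_reflect[of "- 1 - L"] by simp
qed

lemma adjacent_iff:
  assumes "a \<in> {0..<int n}" "b \<in> {0..<int n}"
  shows "(\<exists>e\<in>edges star. ends star e = {vertex c a, vertex c b}) \<longleftrightarrow> (\<exists>p. even (p - c) \<and> step p = (b - a) mod int n)"
proof
  assume "\<exists>e\<in>edges star. ends star e = {vertex c a, vertex c b}"
  then obtain p i where
    "{vertex p ((V p + i) mod int n), vertex p ((V p + i + step p) mod int n)} = {vertex c a, vertex c b}"
    unfolding edges_star using ends_E by force
  then consider "even (p - c)" "(V p + i) mod int n = a" "(V p + i + step p) mod int n = b"
    | "even (p - c)" "(V p + i) mod int n = b" "(V p + i + step p) mod int n = a"
    by (auto simp: doubleton_eq_iff vertex_eq_iff)
  then show "\<exists>p. even (p - c) \<and> step p = (b - a) mod int n"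
  proof cases
    case 1
    then have "(b - a) mod int n = step p mod int n" by (auto simp: mod_simps)
    then show ?thesis using 1(1) step_range[of p] by auto
  next
    \<comment> \<open>The edge leads from \<open>b\<close> to \<open>a\<close>; the reflected
      position has the negated difference and the same parity.\<close>
    case 2
    then have "(b - a) mod int n = (- step p) mod int n" by (auto simp: mod_simps)
    then show ?thesis using 2(1) step_reflect[of p] by (intro exI[of _ "- 2 - p"]) auto
  qed
next
  assume "\<exists>p. even (p - c) \<and> step p = (b - a) mod int n"
  then obtain p where p: "even (p - c)" "step p = (b - a) mod int n" by blast
  have "ends star (E p (a - V p)) = {vertex p a, vertex p b}"
    using assms p(2) by (simp add: ends_E mod_simps)
  moreover have "vertex p a = vertex c a" "vertex p b = vertex c b" using p(1) by (simp_all add: vertex_eq_iff)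
  ultimately show "\<exists>e\<in>edges star. ends star e = {vertex c a, vertex c b}"
    unfolding edges_star by auto
qed

section \<open>Special presentations have odd differences\<close>

text \<open>The connection set of the part of the star graph that the parity of \<open>c\<close>
  selects.\<close>

definition D :: "int \<Rightarrow> int set" where "D c = {step p | p. even (p - c)}"

definition odds :: "int set" where "odds = {d \<in> {0..<int n}. odd d}"

lemma finite_odds: "finite odds"
  by (rule finite_subset[of _ "{0..<int n}"]) (auto simp: odds_def)

lemma step_in_D: "even (p - c) \<Longrightarrow> step p \<in> D c"
  by (auto simp: D_def)

lemma D_eq_image: "D c = step ` {p \<in> {0..<2 * L}. even (p - c)}"
proof (intro equalityI subsetI)
  fix d assume "d \<in> D c"
  then obtain p where p: "even (p - c)" "d = step p" by (auto simp: D_def)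
  have "step p = step (p mod (2 * L))"
    by (intro step_cong) simp
  moreover have "even (p mod (2 * L) - c)"
    using p(1) by (simp add: minus_mult_div_eq_mod[symmetric])
  moreover have "p mod (2 * L) \<in> {0..<2 * L}" using L_pos by simp
  ultimately show "d \<in> step ` {p \<in> {0..<2 * L}. even (p - c)}" using p(2) by blast
qed (auto simp: D_def)

lemma D_subset: "D c \<subseteq> {0..<int n}"
  using step_range by (auto simp: D_def)

lemma card_odds: "card odds = nat h"
  using card_parity_class[of h 1] h_pos by (simp add: odds_def n_eq)

lemma vertex_in_verts_star: "vertex c a \<in> verts star \<longleftrightarrow> a \<in> {0..<int n}"
  unfolding verts_star letters_over_iff subscript_vertex cyc_gens_def ..

section \<open>Consequences of girth 4 and diameter 2\<close>

lemma special_component: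
  assumes "special m k \<nu> (cyclic_presentation n w)" and "x \<in> verts star"
  shows "bipartite (component_of star x)" and "diameter (component_of star x) = enat m"
    and "girth (component_of star x) = enat (2 * m)"
proof -
  have "component_of star x \<in> components star" using assms(2) by (simp add: components_eq)
  then show "bipartite (component_of star x)" "diameter (component_of star x) = enat m"
    "girth (component_of star x) = enat (2 * m)"
    using assms(1) unfolding special_def by blast+
qed

text \<open>Otherwise \<open>T_eq_iff\<close> makes the edges at \<open>p\<close> and
  \<open>q\<close> distinct although they are parallel, and they form a closed walk of length 2,
  contrary to girth 4.\<close>

lemma special_step_inj:
  assumes special: "special 2 k \<nu> (cyclic_presentation n w)" and "step p = step q" and "even (p - q)"
  shows "2 * L dvd p - q"
proof (rule ccontr)
  assume not_dvd: "\<not> 2 * L dvd p - q"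
  define e f where "e = E p (- V p)" and "f = E q (- V q)"
  let ?x = "vertex p 0" and ?y = "vertex p (step p)"
  have ends: "ends star e = {?x, ?y}" "ends star f = {?x, ?y}"
    using assms(2,3) by (simp_all add: e_def f_def ends_E vertex_eq_iff doubleton_eq_iff)
  have edges: "e \<in> edges star" "f \<in> edges star"
    unfolding e_def f_def edges_star by blast+
  have "e \<noteq> f"
  proof
    assume "e = f"
    then have "T p (- V p) = T q (- V q) \<or> T p (- V p) = T (- 2 - q) (- V q + h)"
      unfolding e_def f_def E_def by blast
    moreover have "T p (- V p) \<noteq> T q (- V q)" using not_dvd T_eq_iff by blast
    \<comment> \<open>The word \<open>T p (- V p)\<close> starts at subscript 0, the partner word of
      \<open>f\<close> at subscript \<open>step q\<close>, which is not 0.\<close>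
    moreover have "hd (T p (- V p)) \<noteq> hd (T (- 2 - q) (- V q + h))"
      using step_nonzero[of q] step_range[of q] shift_letter_W_reflect[of "- V q" q]
      by (simp add: shift_letter_W vertex_eq_iff)
    ultimately show False by metis
  qed
  have verts: "?x \<in> verts star" "?y \<in> verts star"
    using step_range n_ge_2 by (simp_all add: vertex_in_verts_star)
  have "walk star ?x [e, f] ?x"
    using ends edges verts by (auto simp: insert_commute)
  then have "walk (component_of star ?x) ?x [e, f] ?x"
    by (rule walk_component_of_self)
  then have "girth (component_of star ?x) \<le> enat (length [e, f])"
    using \<open>e \<noteq> f\<close> girth_le[of "[e, f]" "component_of star ?x" ?x] by (simp del: walk.simps)
  then show False using special_component(3)[OF special verts(1)] by simp
qed

text \<open>The partial sums 0, \<open>a\<close>, \<open>a + b\<close>, \<open>a + b + d\<close>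
  form a walk of length 3, whose ends are adjacent in a bipartite graph of diameter 2.\<close>

lemma special_triple_sum:
  assumes special: "special 2 k \<nu> (cyclic_presentation n w)"
    and abd: "a \<in> D c" "b \<in> D c" "d \<in> D c"
  shows "(a + b + d) mod int n \<in> D c"
proof -
  have adj: "\<exists>e\<in>edges star. ends star e = {vertex c (s mod int n), vertex c ((s + t) mod int n)}"
    if "t \<in> D c" for s t
  proof -
    obtain p where "even (p - c)" "step p = t" using \<open>t \<in> D c\<close> by (auto simp: D_def)
    moreover have "t mod int n = t" using subsetD[OF D_subset that] by simp
    ultimately show ?thesis
      using n_ge_2 by (intro iffD2[OF adjacent_iff]) (auto simp: mod_simps)
  qed
  let ?v = "\<lambda>s. vertex c (s mod int n)"
  have v: "?v s \<in> verts star" for s using n_ge_2 by (simp add: vertex_in_verts_star)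
  obtain e1 e2 e3 where e: "e1 \<in> edges star" "ends star e1 = {?v 0, ?v (0 + a)}"
    "e2 \<in> edges star" "ends star e2 = {?v (0 + a), ?v (0 + a + b)}"
    "e3 \<in> edges star" "ends star e3 = {?v (0 + a + b), ?v (0 + a + b + d)}"
    using adj[OF abd(1)] adj[OF abd(2)] adj[OF abd(3)] by metis
  have "walk star (?v 0) [e1, e2, e3] (?v (0 + a + b + d))"
    using e v unfolding walk.simps by blast
  then have "walk (component_of star (?v 0)) (?v 0) [e1, e2, e3] (?v (0 + a + b + d))"
    by (rule walk_component_of_self)
  then have "\<exists>e\<in>edges (component_of star (?v 0)).
      ends (component_of star (?v 0)) e = {?v 0, ?v (0 + a + b + d)}"
    by (rule bipartite_diameter_2_adjacent[rotated 2])
      (use special_component[OF special v[of 0]] in simp_all)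
  then obtain e where "e \<in> edges (component_of star (?v 0))"
    "ends (component_of star (?v 0)) e = {?v 0, ?v (0 + a + b + d)}"
    by blast
  then have "e \<in> edges star" "ends star e = {vertex c 0, ?v (a + b + d)}"
    by (simp_all add: component_of_def induced_def)
  then obtain p where "even (p - c)" "step p = (a + b + d) mod int n"
    using adjacent_iff[of 0 "(a + b + d) mod int n" c] n_ge_2 by auto
  then show ?thesis by (metis step_in_D)
qed

lemma special_imp_odd_differences:
  assumes special: "special 2 k \<nu> (cyclic_presentation n w)"
    and irred: "irreducible_presentation n w"
  shows "L = h" and "odd h" and "D c = odds"
proof -
  have inj: "inj_on step {p \<in> {0..<2 * L}. even (p - c)}" for c
  proof (rule inj_onI)
    fix p q assume pq: "p \<in> {p \<in> {0..<2 * L}. even (p - c)}" "q \<in> {p \<in> {0..<2 * L}. even (p - c)}"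
      and "step p = step q"
    moreover from pq have "even (p - q)" by auto
    ultimately have "2 * L dvd p - q" by (intro special_step_inj[OF special]) simp_all
    then show "p = q" using residue_eqI[of p "2 * L" q] pq by blast
  qed
  \<comment> \<open>One period contains \<open>L\<close> positions of each parity, and their
    differences are distinct.\<close>
  have card_D: "card (D c) = nat L" for c
    unfolding D_eq_image card_image[OF inj] using L_pos by (intro card_parity_class) simp
  \<comment> \<open>For even \<open>L\<close> the two junctions would have positions of equal parity
    and the same difference \<open>h\<close>, though they are not congruent modulo
    \<open>2 * L\<close>.\<close>
  have "odd L"
  proof
    assume "even L"
    then have "2 * L dvd (L - 1) - (- 1)"
      by (intro special_step_inj[OF special]) (simp_all add: step_L step_minus_1)
    then show False using zdvd_not_zless[of L "2 * L"] L_pos by simp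
  qed
  \<comment> \<open>As \<open>L\<close> is odd, the junctions \<open>L - 1\<close> and -1 have
    different parities.\<close>
  have h_D: "h \<in> D c" for c
  proof (cases "even c")
    case True
    then have "even ((L - 1) - c)" using \<open>odd L\<close> by simp
    then show ?thesis using step_L step_in_D by metis
  next
    case False
    then have "even (- 1 - c)" by simp
    then show ?thesis using step_minus_1 step_in_D by metis
  qed
  have dvd_L: "int n dvd L * (a + h)" if "a \<in> D c" for a c
    using dvd_card_mult_if_triple_sums_closed[OF D_subset special_triple_sum[OF special] that h_D]
      card_D L_pos by simp
  have "int n dvd 2 * L * step p" for p
  proof -
    have "int n dvd L * (step p + h)" using dvd_L[OF step_in_D[of p p]] by simp
    \<comment> \<open>Doubling removes \<open>h\<close>, as \<open>2 * h\<close> is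
      \<open>n\<close>.\<close>
    then have "int n dvd 2 * (L * (step p + h)) - L * int n" by (intro dvd_diff dvd_mult[of _ _ 2]) simp_all
    moreover have "2 * (L * (step p + h)) - L * int n = 2 * L * step p"
      by (simp add: n_eq algebra_simps)
    ultimately show ?thesis by simp
  qed
  then have step: "int n dvd 2 * L * (V (p + 1) - V p)" for p
    using mod_mult_right_eq[of "2 * L" "V (p + 1) - V p" "int n"] unfolding step_def
    by (metis dvd_eq_mod_eq_0)
  have V0: "int n dvd 2 * L * (V (int i) - V 0)" for i
  proof (induction i)
    case (Suc i)
    have "V (int (Suc i)) - V 0 = (V (int i + 1) - V (int i)) + (V (int i) - V 0)"
      by (simp add: add.commute)
    then show ?case using dvd_add[OF step Suc.IH] by (simp only: distrib_left)
  qed simp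
  have "int n dvd 2 * L * (subscript x - subscript y)" if xy: "x \<in> set w" "y \<in> set w" for x y
  proof -
    obtain i j where ij: "subscript x = V (int i)" "subscript y = V (int j)"
      using xy W_nth unfolding in_set_conv_nth V_def by metis
    have "2 * L * (subscript x - subscript y) = 2 * L * (V (int i) - V 0) - 2 * L * (V (int j) - V 0)"
      unfolding ij by (simp add: algebra_simps)
    then show ?thesis using dvd_diff[OF V0 V0] by metis
  qed
  \<comment> \<open>The number \<open>n\<close> divides \<open>2 * L\<close> times each element of
    the set whose gcd is 1 by irreducibility; hence it divides \<open>2 * L\<close>.\<close>
  then have "int n dvd Gcd ((*) (2 * L) `
      insert (int n) {subscript x - subscript y | x y. x \<in> set w \<and> y \<in> set w})"
    by (intro Gcd_greatest) auto
  then have "int n dvd 2 * L"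
    using irred unfolding irreducible_presentation_def Gcd_mult by simp
  then have "h dvd L" by (simp add: n_eq)
  then obtain m where m: "L = h * m" by blast
  have "odd h" "odd m" using \<open>odd L\<close> m by auto
  have "D c \<subseteq> odds" for c
  proof
    fix a assume a: "a \<in> D c"
    \<comment> \<open>Cancelling \<open>h\<close> leaves that 2 divides \<open>m * (a + h)\<close>;
      with \<open>m\<close> and \<open>h\<close> odd, \<open>a\<close> must be odd.\<close>
    have "2 * h dvd h * (m * (a + h))" using dvd_L[OF a] by (simp add: n_eq m mult.assoc)
    then have "2 dvd m * (a + h)" using h_pos by (simp add: mult.commute)
    then have "odd a" using \<open>odd m\<close> \<open>odd h\<close> by auto
    then show "a \<in> odds" using a D_subset[of c] by (auto simp: odds_def subset_iff)
  qed
  \<comment> \<open>There are only \<open>h\<close> odd residues, and \<open>h dvd L\<close> gives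
    the opposite inequality.\<close>
  then have "nat L \<le> nat h" using card_mono[OF finite_odds] card_D card_odds by metis
  moreover have "h \<le> L" using \<open>h dvd L\<close> L_pos by (simp add: zdvd_imp_le)
  ultimately show "L = h" using h_pos by simp
  show "odd h" by fact
  show "D c = odds"
    using card_subset_eq[OF finite_odds \<open>D c \<subseteq> odds\<close>] card_D card_odds \<open>L = h\<close> by simp
qed

section \<open>Odd differences give complete bipartite graphs\<close>

definition part :: "int \<Rightarrow> int letter set" where "part c = vertex c ` {0..<int n}"

definition side :: "int \<Rightarrow> int \<Rightarrow> int letter set" where
  "side c r = vertex c ` {a \<in> {0..<int n}. even (a - r)}"

lemma part_cong: "even (c - d) \<Longrightarrow> part c = part d"
  unfolding part_def by (intro image_cong refl) (simp add: vertex_eq_iff)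

lemma part_0_1: "part c = part 0 \<or> part c = part 1"
  using part_cong[of c 0] part_cong[of c 1] by auto

lemma card_side: "card (side c r) = nat h"
proof -
  have "inj_on (vertex c) A" for A by (simp add: inj_on_def vertex_eq_iff)
  then show ?thesis
    unfolding side_def by (subst card_image) (use card_parity_class[of h r] h_pos n_eq in simp_all)
qed

lemma even_mod_n: "even (x mod int n) \<longleftrightarrow> even x"
  using even_n by (simp add: dvd_mod_iff)

lemma E_eqI:
  assumes inj: "step p = step q \<Longrightarrow> even (p - q) \<Longrightarrow> 2 * L dvd p - q"
    and "even (p - q)" "step p = step q" "(V p + i) mod int n = (V q + j) mod int n"
  shows "E p i = E q j"
proof -
  have "2 * L dvd p - q" using assms by blast
  moreover from this have "V p = V q" using W_cong by (simp add: V_def)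
  then have "int n dvd i - j" using assms(4) by (simp add: mod_eq_dvd_iff)
  moreover from \<open>2 * L dvd p - q\<close> have "2 * L dvd (- 2 - p) - (- 2 - q)"
    by (simp add: dvd_diff_commute)
  ultimately show ?thesis
    unfolding E_def using T_cong[of p q i j] T_cong[of "- 2 - p" "- 2 - q" "i + h" "j + h"] by simp
qed

text \<open>The endpoints match either in order or crosswise. In the first case the differences
  agree; the second reduces to it by writing the second edge from its reflected position, as in
  \<open>E_reflect\<close>.\<close>

lemma ends_E_inj:
  assumes inj: "\<And>p q. step p = step q \<Longrightarrow> even (p - q) \<Longrightarrow> 2 * L dvd p - q"
    and eq: "ends star (E p i) = ends star (E q j)"
  shows "E p i = E q j"
proof -
  consider "even (p - q)" "(V p + i) mod int n = (V q + j) mod int n"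
      "(V p + i + step p) mod int n = (V q + j + step q) mod int n"
    | "even (p - q)" "(V p + i) mod int n = (V q + j + step q) mod int n"
      "(V p + i + step p) mod int n = (V q + j) mod int n"
    using eq unfolding ends_E doubleton_eq_iff vertex_eq_iff by blast
  then show ?thesis
  proof cases
    case 1
    have "int n dvd ((V p + i + step p) - (V q + j + step q)) - ((V p + i) - (V q + j))"
      using 1(2,3) unfolding mod_eq_dvd_iff by (rule dvd_diff[rotated])
    then have "step p = step q" by (intro residue_eqI[OF step_range step_range]) (simp add: algebra_simps)
    then show ?thesis using 1 inj by (intro E_eqI)
  next
    case 2
    have "int n dvd ((V p + i + step p) - (V q + j)) - ((V p + i) - (V q + j + step q))"
      using 2(2,3) unfolding mod_eq_dvd_iff by (rule dvd_diff[rotated])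
    then have "step p mod int n = (- step q) mod int n"
      unfolding mod_eq_dvd_iff by (simp add: algebra_simps)
    then have "step p = step (- 2 - q)" by (simp add: step_reflect)
    moreover have "(V (- 2 - q) + (j + h)) mod int n = (V q + j + step q) mod int n"
      using shift_letter_W_reflect[of j q] unfolding shift_letter_W vertex_eq_iff by simp
    moreover have "even (p - (- 2 - q))" using 2(1) by simp
    ultimately have "E p i = E (- 2 - q) (j + h)" using 2(2) inj by (intro E_eqI) simp_all
    then show ?thesis by (simp only: E_reflect)
  qed
qed

text \<open>The \<open>L\<close> positions map onto the \<open>h\<close> odd residues, and
  \<open>L = h\<close>.\<close>

lemma inj_on_step:
  assumes "L = h" "D c = odds"
  shows "inj_on step {p \<in> {0..<2 * L}. even (p - c)}"
proof (rule eq_card_imp_inj_on)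
  have "card {p \<in> {0..<2 * L}. even (p - c)} = nat L"
    using L_pos by (intro card_parity_class) simp
  then show "card (step ` {p \<in> {0..<2 * L}. even (p - c)}) = card {p \<in> {0..<2 * L}. even (p - c)}"
    using assms card_odds unfolding D_eq_image by simp
qed (rule finite_subset[of _ "{0..<2 * L}"], auto)

lemma step_eq_D:
  assumes "L = h" "\<And>c. D c = odds" and "step p = step q" "even (p - q)"
  shows "2 * L dvd p - q"
proof -
  let ?p = "p mod (2 * L)" and ?q = "q mod (2 * L)"
  have "step p = step ?p" "step q = step ?q" by (intro step_cong dvd_minus_mod)+
  moreover have "even (?p - q)" "even (?q - q)"
    using assms(4) by (simp_all add: minus_mult_div_eq_mod[symmetric])
  moreover have "?p \<in> {0..<2 * L}" "?q \<in> {0..<2 * L}" using L_pos by simp_all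
  ultimately have "?p = ?q"
    using inj_on_step[OF assms(1,2), of q] assms(3) by (auto dest!: inj_onD[where x = ?p and y = ?q])
  then show ?thesis by (simp add: mod_eq_dvd_iff)
qed

text \<open>As \<open>n\<close> is even, odd differences join even to odd subscripts. Every odd
  residue occurs, so every such pair is joined; it is joined only once because positions of one
  parity in a period have distinct differences.\<close>

lemma complete_bipartite_part:
  assumes "L = h" and D: "\<And>c. D c = odds"
  shows "complete_bipartite (induced star (part c)) (side c 0) (side c 1)"
proof
  show "verts (induced star (part c)) = side c 0 \<union> side c 1"
    by (auto simp: induced_def part_def side_def)
  show "side c 0 \<inter> side c 1 = {}"
    by (auto simp: side_def vertex_eq_iff)
  let ?E = "{e \<in> edges star. ends star e \<subseteq> part c}"
  let ?S = "{{x, y} | x y. x \<in> side c 0 \<and> y \<in> side c 1}"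
  have "bij_betw (ends star) ?E ?S"
  proof (rule bij_betw_imageI)
    show "inj_on (ends star) ?E"
    proof (rule inj_onI)
      fix e f assume "e \<in> ?E" "f \<in> ?E" and eq: "ends star e = ends star f"
      then obtain p i q j where ef: "e = E p i" "f = E q j" unfolding edges_star by blast
      show "e = f"
        using eq ends_E_inj[OF step_eq_D[OF assms]] unfolding ef by blast
    qed
    show "ends star ` ?E = ?S"
    proof (intro equalityI subsetI)
      fix s assume "s \<in> ends star ` ?E"
      then obtain p i where s: "s = ends star (E p i)" "ends star (E p i) \<subseteq> part c"
        unfolding edges_star by blast
      let ?a = "(V p + i) mod int n" and ?b = "(V p + i + step p) mod int n"
      have ab: "?a \<in> {0..<int n}" "?b \<in> {0..<int n}" using n_ge_2 by simp_all
      have "even (p - c)" using s(2) unfolding ends_E part_def by (auto simp: vertex_eq_iff)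
      then have s_eq: "s = {vertex c ?a, vertex c ?b}" unfolding s(1) ends_E by (auto simp: vertex_eq_iff)
      have "odd (step p)" using D[of p] step_in_D[of p p] by (simp add: odds_def)
      then have parity: "even ?a \<longleftrightarrow> odd ?b" unfolding even_mod_n by simp
      show "s \<in> ?S"
      proof (cases "even ?a")
        case True
        then have "vertex c ?a \<in> side c 0" "vertex c ?b \<in> side c 1"
          using ab parity unfolding side_def by auto
        then show ?thesis using s_eq by blast
      next
        case False
        then have "vertex c ?b \<in> side c 0" "vertex c ?a \<in> side c 1"
          using ab parity unfolding side_def by auto
        then show ?thesis using s_eq by blast
      qed
    next
      fix s assume "s \<in> ?S"
      then obtain a b where ab: "s = {vertex c a, vertex c b}" "a \<in> {0..<int n}" "even a" "b \<in> {0..<int n}" "odd b"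
        by (auto simp: side_def)
      have "(b - a) mod int n \<in> D c"
        using ab n_ge_2 unfolding D odds_def by (simp add: even_mod_n)
      then obtain e where "e \<in> edges star" "ends star e = s"
        using adjacent_iff[OF ab(2,4), of c] ab(1) unfolding D_def by auto
      moreover have "s \<subseteq> part c" using ab by (auto simp: part_def)
      ultimately show "s \<in> ends star ` ?E" by blast
    qed
  qed
  then show "bij_betw (ends (induced star (part c))) (edges (induced star (part c))) ?S"
    by (simp add: induced_def)
qed

section \<open>Components of the star graph and their invariants\<close>

lemma side_nonempty: "side c r \<noteq> {}"
  using card_side[of c r] h_pos by auto

lemma finite_side: "finite (side c r)"
  unfolding side_def
  by (intro finite_imageI) (rule finite_subset[of _ "{0..<int n}"], auto)

lemma components_star:
  assumes "L = h" and "\<And>c. D c = odds"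
  shows "components star = {induced star (part 0), induced star (part 1)}"
    and "card (components star) = 2"
proof -
  have conn: "connected_graph (induced star (part c))" for c
    using complete_bipartite.connected_graph[OF complete_bipartite_part[OF assms]] side_nonempty by blast
  have verts: "verts star = part 0 \<union> part 1"
  proof (intro equalityI subsetI)
    fix x assume "x \<in> verts star"
    then have "subscript x \<in> {0..<int n}" by (simp add: verts_star letters_over_iff cyc_gens_def)
    then show "x \<in> part 0 \<union> part 1" using letter_eq_vertex[of x] unfolding part_def by blast
  next
    fix x assume "x \<in> part 0 \<union> part 1"
    then show "x \<in> verts star" unfolding part_def using vertex_in_verts_star by blast
  qed
  have edges: "ends star e \<subseteq> part 0 \<or> ends star e \<subseteq> part 1" if e: "e \<in> edges star" for e
  proof -
    obtain p i where "e = E p i" using e unfolding edges_star by blast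
    then have "ends star e \<subseteq> part p" using n_ge_2 by (auto simp: ends_E part_def)
    then show ?thesis using part_0_1[of p] by auto
  qed
  have disjoint: "part 0 \<inter> part 1 = {}" by (auto simp: part_def vertex_eq_iff)
  show *: "components star = {induced star (part 0), induced star (part 1)}"
    by (rule components_two_parts(1)[OF verts edges disjoint conn conn])
  have "induced star (part 0) \<noteq> induced star (part 1)"
    by (rule components_two_parts(2)[OF verts edges disjoint conn conn])
  then show "card (components star) = 2" unfolding * by simp
qed

lemma reduced_T: "reduced (T p i)"
  unfolding reduced_iff_nth
proof (intro allI impI)
  fix s assume s: "Suc s < length (T p i)"
  let ?q = "p + int s"
  have "shift_letter i (W (?q + 1)) \<noteq> shift_letter i (letter_inv (W ?q))"
  proof
    assume "shift_letter i (W (?q + 1)) = shift_letter i (letter_inv (W ?q))"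
    then have "int n dvd V (?q + 1) - V ?q" by (simp add: shift_letter_eq_iff V_def)
    then show False using residue_eqI[OF V_range V_range] V_Suc_neq by blast
  qed
  then show "T p i ! Suc s \<noteq> letter_inv (T p i ! s)"
    using s by (simp add: T_nth letter_inv_shift_letter add_ac)
qed

lemma special_if_odd_differences:
  assumes "L = h" and "\<And>c. D c = odds" and "h \<ge> 3"
  shows "special 2 (length w) 2 (cyclic_presentation n w)"
proof -
  have set_T: "set (T p i) \<subseteq> letters_over (cyc_gens n)" for p i
    using n_ge_2 by (auto simp: T_def letters_over_iff cyc_gens_def)
  have snd: "snd (cyclic_presentation n w) = range (T 0)"
    unfolding cyclic_presentation_def relators_eq by simp
  have fin: "finite_presentation (cyclic_presentation n w)"
  proof -
    have "finite relators" by simp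
    moreover have "relators \<subseteq> carrier (free_group (cyc_gens n))"
      unfolding relators_eq free_group_def using set_T reduced_T by (auto simp: in_lists_conv_set)
    ultimately show ?thesis unfolding cyclic_presentation_def by (simp add: cyc_gens_def)
  qed
  have cyc: "\<forall>r\<in>snd (cyclic_presentation n w). cyclically_reduced r"
    unfolding snd cyclically_reduced_def using reduced_T by (auto simp: rotate_T)
  have comps: "\<exists>c. C = induced star (part c)" if "C \<in> components star" for C
    using that unfolding components_star[OF assms(1,2)] by blast
  have iso: "\<forall>C\<in>components star. \<forall>C'\<in>components star. graph_iso C C'"
  proof (intro ballI)
    fix C C' assume "C \<in> components star" "C' \<in> components star"
    then obtain c c' where "C = induced star (part c)" "C' = induced star (part c')"
      using comps by blast
    then show "graph_iso C C'"
      using complete_bipartite_iso[OF complete_bipartite_part[OF assms(1,2)]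
          complete_bipartite_part[OF assms(1,2)]] finite_side card_side by simp
  qed
  have "connected_graph C \<and> bipartite C \<and> diameter C = enat 2 \<and> girth C = enat (2 * 2) \<and>
      (\<forall>x\<in>verts C. degree C x \<ge> 3)" if CC: "C \<in> components star" for C
  proof -
    obtain c where C: "C = induced star (part c)" using comps[OF CC] by blast
    interpret complete_bipartite C "side c 0" "side c 1"
      unfolding C by (rule complete_bipartite_part[OF assms(1,2)])
    have "\<exists>x\<in>side c r. \<exists>y\<in>side c r. x \<noteq> y" for r
      using card_side[of c r] \<open>h \<ge> 3\<close> card_le_Suc0_iff_eq[OF finite_side[of c r]] by force
    then obtain x x' y y' where "x \<in> side c 0" "x' \<in> side c 0" "x \<noteq> x'" "y \<in> side c 1" "y' \<in> side c 1" "y \<noteq> y'"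
      by metis
    then have "diameter C = enat 2" "girth C = enat 4"
      using diameter girth side_nonempty by blast+
    moreover have "degree C z \<ge> 3" if "z \<in> verts C" for z
      using degree_ge[OF finite_side finite_side that] card_side \<open>h \<ge> 3\<close> by simp
    ultimately show ?thesis using connected_graph bipartite side_nonempty by simp
  qed
  moreover have "length w \<ge> 4" using length_w_int assms by linarith
  ultimately show ?thesis
    unfolding special_def using fin cyc iso components_star(2)[OF assms(1,2)] by (auto simp: snd)
qed

section \<open>The multisets of differences\<close>

lemma zip_u: "zip u (tl u) = map (\<lambda>i. (W (int i), W (int i + 1))) [0..<length u - 1]"
proof (rule nth_equalityI)
  fix i assume "i < length (zip u (tl u))"
  then have "i < length u" "Suc i < length u" by auto
  then show "zip u (tl u) ! i = map (\<lambda>i. (W (int i), W (int i + 1))) [0..<length u - 1] ! i"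
    using W_nth_u[of i] W_nth_u[of "Suc i"] by (simp add: nth_tl add.commute)
qed simp

lemma image_mset_filter_upt:
  "image_mset (\<lambda>i. step (int i)) {#i \<in># mset [0..<length u - 1]. P (int i)#}
    = image_mset step (mset_set {p \<in> {0..<L - 1}. P p})"
proof -
  have "{p \<in> {0..<L - 1}. P p} = int ` {i \<in> {0..<length u - 1}. P (int i)}"
  proof (intro equalityI subsetI)
    fix p assume p: "p \<in> {p \<in> {0..<L - 1}. P p}"
    then have "p = int (nat p)" "nat p < length u - 1" by (auto simp: L_def)
    then show "p \<in> int ` {i \<in> {0..<length u - 1}. P (int i)}" using p by (intro image_eqI) auto
  qed (auto simp: L_def)
  then show ?thesis
    by (simp add: image_mset_mset_set[symmetric] multiset.map_comp o_def filter_mset_mset_set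
        flip: mset_upt mset_set_upto_eq_mset_upto)
qed

text \<open>As signs alternate, the sign of the first letter of a pair decides which pattern the
  pair matches.\<close>

lemma A_prime_eq: "A_prime n u = image_mset step (mset_set {p \<in> {0..<L - 1}. positive (W p)})"
proof -
  have "(case (W p, W (p + 1)) of (Pos i, Neg j) \<Rightarrow> [(j - i) mod int n] | _ \<Rightarrow> [])
      = (if positive (W p) then [step p] else [])" for p
    using W_Suc(1)[of p] by (cases "W p"; cases "W (p + 1)") (simp_all add: step_def V_def)
  then show ?thesis
    unfolding A_prime_def zip_u map_map o_def
      image_mset_filter_upt[of "\<lambda>p. positive (W p)", symmetric] mset_concat_if_singleton[symmetric]
    by (simp only:)
qed

lemma B_prime_eq: "B_prime n u = image_mset step (mset_set {p \<in> {0..<L - 1}. \<not> positive (W p)})"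
proof -
  have "(case (W p, W (p + 1)) of (Neg i, Pos j) \<Rightarrow> [(j - i) mod int n] | _ \<Rightarrow> [])
      = (if \<not> positive (W p) then [step p] else [])" for p
    using W_Suc(1)[of p] by (cases "W p"; cases "W (p + 1)") (simp_all add: step_def V_def)
  then show ?thesis
    unfolding B_prime_def zip_u map_map o_def
      image_mset_filter_upt[of "\<lambda>p. \<not> positive (W p)", symmetric] mset_concat_if_singleton[symmetric]
    by (simp only:)
qed

text \<open>The bound \<open>L - 1\<close> keeps both \<open>p\<close> and \<open>p + 1\<close>
  inside \<open>u\<close>, so no junction is included.\<close>

definition Q :: "int \<Rightarrow> int set" where "Q c = {p \<in> {0..<L - 1}. even (p - c)}"

text \<open>When \<open>L\<close> is odd, the single \<open>h\<close> stands for the one junction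
  whose position has the parity of \<open>c\<close>.\<close>

definition M :: "int \<Rightarrow> int multiset" where "M c = image_mset step (mset_set (Q c)) + {#h#}"

text \<open>For odd \<open>L\<close> the first and last letters of \<open>u\<close> have equal sign,
  so each multiset receives one \<open>h\<close>; the sign of \<open>W 0\<close> decides which
  parity belongs to which multiset.\<close>

lemma AB_bar_eq:
  assumes "odd L"
  shows "AB_bar n u = (if positive (W 0) then (M 0, M 1) else (M 1, M 0))"
proof -
  have "hd u = W 0" using W_nth_u[of 0] u_nonempty by (simp add: hd_conv_nth)
  moreover have "last u = W (L - 1)"
    using W_nth_u[of "length u - 1"] u_nonempty by (simp add: last_conv_nth L_def of_nat_diff Suc_leI)
  moreover have "positive (W (L - 1)) \<longleftrightarrow> positive (W 0)"
    using positive_W[of "L - 1"] assms by simp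
  moreover have "A_prime n u + {#h#} = M 0 \<and> B_prime n u + {#h#} = M 1" if pos: "positive (W 0)"
  proof -
    have "positive (W p) \<longleftrightarrow> even p" for p using positive_W[of p] pos by simp
    then show ?thesis unfolding A_prime_eq B_prime_eq M_def Q_def by simp
  qed
  moreover have "A_prime n u + {#h#} = M 1 \<and> B_prime n u + {#h#} = M 0" if neg: "\<not> positive (W 0)"
  proof -
    have "positive (W p) \<longleftrightarrow> odd p" for p using positive_W[of p] neg by simp
    then show ?thesis unfolding A_prime_eq B_prime_eq M_def Q_def by simp
  qed
  ultimately show ?thesis
    unfolding AB_bar_def Let_def h_def[symmetric] by (cases "W 0"; cases "W (L - 1)") auto
qed

lemma finite_Q: "finite (Q c)"
  unfolding Q_def by (rule finite_subset[of _ "{0..<L - 1}"]) auto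

text \<open>A period consists of the positions inside \<open>u\<close>, the two junctions, and the
  positions inside the inverse half, which the reflection pairs with the first kind while negating
  the difference.\<close>

lemma D_eq:
  assumes "odd L"
  shows "D c = insert h (step ` Q c \<union> (\<lambda>p. (- step p) mod int n) ` Q c)"
proof (intro equalityI subsetI)
  fix d assume "d \<in> D c"
  then obtain p where p: "d = step p" "0 \<le> p" "p < 2 * L" "even (p - c)" unfolding D_eq_image by auto
  consider "p < L - 1" | "p = L - 1" | "p = 2 * L - 1" | "L \<le> p" "p < 2 * L - 1"
    using p(2,3) by linarith
  then show "d \<in> insert h (step ` Q c \<union> (\<lambda>p. (- step p) mod int n) ` Q c)"
  proof cases
    case 1
    then show ?thesis using p by (auto simp: Q_def)
  next
    case 2
    then show ?thesis using p(1) step_L by simp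
  next
    case 3
    then have "step p = step (- 1)" by (intro step_cong) simp
    then show ?thesis using p(1) step_minus_1 by simp
  next
    case 4
    \<comment> \<open>This is the reflected position \<open>- 2 - p\<close>, moved into
      \<open>u\<close> by one period.\<close>
    define q where "q = 2 * L - 2 - p"
    have "q \<in> Q c" using 4 p(4) by (auto simp: q_def Q_def)
    moreover have "step p = step (- 2 - q)" by (intro step_cong) (simp add: q_def)
    ultimately show ?thesis using p(1) step_reflect by simp
  qed
next
  fix d assume "d \<in> insert h (step ` Q c \<union> (\<lambda>p. (- step p) mod int n) ` Q c)"
  then consider "d = h" | p where "p \<in> Q c" "d = step p" | p where "p \<in> Q c" "d = step (- 2 - p)"
    using step_reflect by force
  then show "d \<in> D c"
  proof cases
    case 1
    have "even (L - 1 - c) \<or> even (- 1 - c)" using assms by simp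
    then show ?thesis using 1 step_in_D[of "L - 1" c] step_in_D[of "- 1" c] step_L step_minus_1 by auto
  next
    case 2
    then show ?thesis by (auto simp: Q_def intro!: step_in_D)
  next
    case 3
    then show ?thesis by (auto simp: Q_def intro!: step_in_D)
  qed
qed

lemma D_uminus: "d \<in> D c \<Longrightarrow> (- d) mod int n \<in> D c"
proof -
  assume "d \<in> D c"
  then obtain p where "d = step p" "even (p - c)" by (auto simp: D_def)
  then show ?thesis using step_in_D[of "- 2 - p" c] step_reflect[of p] by simp
qed

text \<open>The upper bound is \<open>h - 2\<close>; for odd \<open>h\<close> these represent, up to
  sign, the odd residues other than \<open>h\<close>.\<close>

abbreviation C :: "int set" where "C \<equiv> {c. odd c \<and> 1 \<le> c \<and> c \<le> (int n - 4) div 2}"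

lemma odds_eq:
  assumes "odd h"
  shows "odds = insert h (C \<union> (\<lambda>c. (- c) mod int n) ` C)"
proof (intro equalityI subsetI)
  fix x assume x: "x \<in> odds"
  then have x': "0 \<le> x" "x < 2 * h" "odd x" by (auto simp: odds_def n_eq)
  \<comment> \<open>Parity rules out the neighbours of \<open>h\<close>, so unless \<open>x\<close>
    is \<open>h\<close>, either \<open>x\<close> or \<open>2 * h - x\<close> lies in
    \<open>C\<close>.\<close>
  have "x \<noteq> 0" "x \<noteq> h - 1" "x \<noteq> h + 1" using x'(3) assms by auto
  then consider "x = h" | "x \<le> h - 2" | "x \<ge> h + 2" by linarith
  then show "x \<in> insert h (C \<union> (\<lambda>c. (- c) mod int n) ` C)"
  proof cases
    case 2
    then have "x \<in> C" using x' \<open>x \<noteq> 0\<close> by (auto simp: n_eq)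
    then show ?thesis by blast
  next
    case 3
    have "(- (2 * h - x)) mod int n = (x - int n) mod int n" by (simp add: n_eq)
    also have "\<dots> = x" using x' n_eq by simp
    finally have "x = (- (2 * h - x)) mod int n" ..
    moreover have "2 * h - x \<in> C" using 3 x' by (auto simp: n_eq)
    ultimately show ?thesis by blast
  qed simp
next
  fix x assume "x \<in> insert h (C \<union> (\<lambda>c. (- c) mod int n) ` C)"
  then consider "x = h" | "x \<in> C" | c where "c \<in> C" "x = (- c) mod int n" by blast
  then show "x \<in> odds"
  proof cases
    case 1
    then show ?thesis using assms h_pos by (simp add: odds_def n_eq)
  next
    case 2
    then show ?thesis using h_pos by (auto simp: odds_def n_eq)
  next
    case 3
    then have "odd x" using even_mod_n by auto
    then show ?thesis using 3(2) n_ge_2 by (simp add: odds_def)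
  qed
qed

lemma uminus_uminus_mod: "d \<in> {0..<int n} \<Longrightarrow> (- ((- d) mod int n)) mod int n = d"
  by (simp add: mod_simps)

lemma C_range: "c \<in> C \<Longrightarrow> c \<in> {0..<int n} \<and> c \<noteq> h \<and> (- c) mod int n \<noteq> h"
proof -
  assume c: "c \<in> C"
  then have c': "1 \<le> c" "c \<le> h - 2" by (auto simp: n_eq)
  have "(- c) mod int n = (2 * h - c) mod int n" using mod_add_self2[of "- c" "int n"] by (simp add: n_eq)
  also have "\<dots> = 2 * h - c" using c' n_eq by (intro mod_pos_pos_trivial) auto
  finally show ?thesis using c' n_eq by auto
qed

text \<open>Negation recovers all odd residues from one sign each, and a count shows that
  \<open>D c\<close> has no others. Conversely, if \<open>D c\<close> is the set of odd residues,
  opposite differences other than \<open>h\<close> sit at a position and its reflection, exactly one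
  of which lies inside \<open>u\<close>; this chooses the sign.\<close>

lemma pm_form_iff:
  assumes "L = h" "odd h"
  shows "pm_form n C (M c) \<longleftrightarrow> D c = odds"
proof
  assume "pm_form n C (M c)"
  then obtain \<epsilon> :: "int \<Rightarrow> int" where \<epsilon>: "\<forall>c\<in>C. \<epsilon> c \<in> {1, - 1}"
    and M: "set_mset (M c) = insert h ((\<lambda>c. (\<epsilon> c * c) mod int n) ` C)"
    unfolding pm_form_def h_def by blast
  have D: "D c = insert h (step ` Q c \<union> (\<lambda>p. (- step p) mod int n) ` Q c)"
    using D_eq assms by simp
  have C: "x \<in> D c \<and> (- x) mod int n \<in> D c" if x: "x \<in> C" for x
  proof -
    have x_mod: "x mod int n = x" using C_range[OF x] by simp
    have "(\<epsilon> x * x) mod int n \<in> set_mset (M c)" using M x by blast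
    moreover have "set_mset (M c) \<subseteq> D c" unfolding D M_def using finite_Q by auto
    ultimately have *: "(\<epsilon> x * x) mod int n \<in> D c" by blast
    consider "\<epsilon> x = 1" | "\<epsilon> x = - 1" using \<epsilon> x by blast
    then show ?thesis
    proof cases
      case 1
      then show ?thesis using * x_mod D_uminus[of x c] by simp
    next
      case 2
      then show ?thesis using * D_uminus[OF *] uminus_uminus_mod[of x] C_range[OF x] by simp
    qed
  qed
  have "odds \<subseteq> D c" unfolding odds_eq[OF assms(2)] using C D by auto
  moreover have "finite (D c)" using D_subset finite_subset by blast
  moreover have "card (D c) \<le> card odds"
  proof -
    have "card (D c) \<le> card {p \<in> {0..<2 * L}. even (p - c)}"
      unfolding D_eq_image
      by (intro card_image_le) (rule finite_subset[of _ "{0..<2 * L}"], auto)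
    then show ?thesis using card_parity_class[of L c] L_pos card_odds assms(1) by simp
  qed
  ultimately show "D c = odds" using card_seteq by metis
next
  assume D_odds: "D c = odds"
  have D: "D c = insert h (step ` Q c \<union> (\<lambda>p. (- step p) mod int n) ` Q c)"
    using D_eq assms by simp
  have inj: "p = q" if "p \<in> {0..<2 * L}" "q \<in> {0..<2 * L}" "even (p - c)" "even (q - c)" "step p = step q" for p q
    using inj_onD[OF inj_on_step[OF assms(1) D_odds]] that by blast
  have Q_inj: "inj_on step (Q c)"
    using inj by (auto simp: inj_on_def Q_def)
  \<comment> \<open>The junction of the parity of \<open>c\<close> already has difference
    \<open>h\<close> and lies outside \<open>Q c\<close>.\<close>
  have h_notin: "h \<notin> step ` Q c"
  proof
    assume "h \<in> step ` Q c"
    then obtain q where q: "q \<in> Q c" "step q = h" by auto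
    have "even (L - 1 - c) \<or> even (2 * L - 1 - c)" using assms by simp
    moreover have "step (2 * L - 1) = h" using step_cong[of "2 * L - 1" "- 1"] step_minus_1 by simp
    ultimately have "q = L - 1 \<or> q = 2 * L - 1"
      using q step_L L_pos inj[of q "L - 1"] inj[of q "2 * L - 1"] by (auto simp: Q_def)
    then show False using q(1) L_pos by (auto simp: Q_def)
  qed
  have M: "M c = mset_set (insert h (step ` Q c))"
    using Q_inj h_notin finite_Q by (simp add: M_def image_mset_mset_set)
  then have count: "count (M c) x \<le> 1" for x by (simp add: count_mset_set')
  \<comment> \<open>Injectivity would make the second position \<open>2 * L - 2 - p\<close>, which
    is at least \<open>L\<close>.\<close>
  have not_both: False if "d \<in> step ` Q c" "(- d) mod int n \<in> step ` Q c" for d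
  proof -
    obtain p q where pq: "p \<in> Q c" "q \<in> Q c" "d = step p" "(- d) mod int n = step q"
      using \<open>d \<in> step ` Q c\<close> \<open>(- d) mod int n \<in> step ` Q c\<close> by auto
    have "step (2 * L - 2 - p) = step (- 2 - p)" by (intro step_cong) simp
    also have "\<dots> = step q" using pq by (simp only: step_reflect)
    finally have "2 * L - 2 - p = q"
      using pq(1,2) by - (rule inj, simp_all add: Q_def)
    then show False using pq(1,2) by (auto simp: Q_def)
  qed
  define \<epsilon> :: "int \<Rightarrow> int" where "\<epsilon> x = (if x \<in> step ` Q c then 1 else - 1)" for x
  have "step ` Q c = (\<lambda>x. (\<epsilon> x * x) mod int n) ` C"
  proof (intro equalityI subsetI)
    fix d assume d: "d \<in> step ` Q c"
    then have "d \<in> odds" "d \<noteq> h" using D D_odds h_notin by blast+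
    then consider "d \<in> C" | x where "x \<in> C" "d = (- x) mod int n"
      unfolding odds_eq[OF assms(2)] by blast
    then show "d \<in> (\<lambda>x. (\<epsilon> x * x) mod int n) ` C"
    proof cases
      case 1
      then show ?thesis using d C_range[OF 1] by (intro image_eqI[of _ _ d]) (simp_all add: \<epsilon>_def)
    next
      case 2
      then have "x \<notin> step ` Q c" using d not_both by blast
      then show ?thesis using 2 by (intro image_eqI[of _ _ x]) (simp_all add: \<epsilon>_def)
    qed
  next
    fix y assume "y \<in> (\<lambda>x. (\<epsilon> x * x) mod int n) ` C"
    then obtain x where x: "x \<in> C" "y = (\<epsilon> x * x) mod int n" by blast
    show "y \<in> step ` Q c"
    proof (cases "x \<in> step ` Q c")
      case True
      then show ?thesis using x C_range[OF x(1)] by (simp add: \<epsilon>_def)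
    next
      case False
      have "x \<in> D c" using x(1) D_odds odds_eq[OF assms(2)] by blast
      then obtain p where p: "p \<in> Q c" "x = (- step p) mod int n"
        using False C_range[OF x(1)] unfolding D by blast
      then show ?thesis
        using False x(2) uminus_uminus_mod[OF step_range[of p]] by (simp add: \<epsilon>_def)
    qed
  qed
  then have "set_mset (M c) = insert (int n div 2) ((\<lambda>x. (\<epsilon> x * x) mod int n) ` C)"
    unfolding M h_def[symmetric] using finite_Q by simp
  moreover have "\<forall>x\<in>C. \<epsilon> x \<in> {1, - 1}" by (simp add: \<epsilon>_def)
  ultimately show "pm_form n C (M c)"
    unfolding pm_form_def using count by blast
qed

section \<open>Both parities and both directions together\<close>

lemma D_parity: "D c = D 0 \<or> D c = D 1"
proof -
  have "D c = D d" if "even (c - d)" for d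
  proof -
    have "even (p - c) \<longleftrightarrow> even (p - d)" for p using that by auto
    then show ?thesis by (simp only: D_def)
  qed
  from this[of 0] this[of 1] show ?thesis by (cases "even c") simp_all
qed

lemma pm_forms_iff:
  assumes "L = h" "odd h"
  shows "pm_form n C (fst (AB_bar n u)) \<and> pm_form n C (snd (AB_bar n u)) \<longleftrightarrow> (\<forall>c. D c = odds)"
proof -
  have "(\<forall>c. D c = odds) \<longleftrightarrow> D 0 = odds \<and> D 1 = odds" using D_parity by metis
  then show ?thesis using AB_bar_eq pm_form_iff[OF assms] assms by auto
qed

lemma special_iff:
  assumes "irreducible_presentation n w"
  shows "special 2 (length w) \<nu> (cyclic_presentation n w) \<longleftrightarrow>
    length u = n div 2 \<and> n div 2 \<ge> 3 \<and> odd (n div 2) \<and> \<nu> = 2 \<and>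
    pm_form n C (fst (AB_bar n u)) \<and> pm_form n C (snd (AB_bar n u))"
proof
  assume special: "special 2 (length w) \<nu> (cyclic_presentation n w)"
  note odd_differences = special_imp_odd_differences[OF special assms]
  have "\<nu> = 2"
    using special components_star(2)[OF odd_differences(1,3)] by (simp add: special_def)
  moreover have "length w \<ge> 4" using special by (simp add: special_def)
  \<comment> \<open>The length of \<open>w\<close> is \<open>2 * h\<close>, so length at least 4
    excludes \<open>h = 1\<close>, and the next odd value is 3.\<close>
  then have "h \<noteq> 1" using odd_differences(1) length_w_int by linarith
  then have "h \<ge> 3" using odd_differences(2) h_pos by presburger
  moreover have "int (n div 2) = h" by (simp add: h_def zdiv_int)
  moreover have "length u = n div 2" using odd_differences(1) calculation by (simp add: L_def)
  moreover have "odd (n div 2)" using odd_differences(2) calculation by presburger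
  ultimately show "length u = n div 2 \<and> n div 2 \<ge> 3 \<and> odd (n div 2) \<and> \<nu> = 2 \<and>
      pm_form n C (fst (AB_bar n u)) \<and> pm_form n C (snd (AB_bar n u))"
    using pm_forms_iff[OF odd_differences(1,2)] odd_differences(3) by auto
next
  assume *: "length u = n div 2 \<and> n div 2 \<ge> 3 \<and> odd (n div 2) \<and> \<nu> = 2 \<and>
    pm_form n C (fst (AB_bar n u)) \<and> pm_form n C (snd (AB_bar n u))"
  have h: "h = int (n div 2)" by (simp add: h_def zdiv_int)
  have "L = h" "odd h" "h \<ge> 3" using * by (simp_all add: L_def h)
  then show "special 2 (length w) \<nu> (cyclic_presentation n w)"
    using * pm_forms_iff special_if_odd_differences by blast
qed

end

theorem theorem6p6:
  fixes n k \<nu> :: nat and u w :: "int word"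
  assumes "n \<ge> 2" and "even n"
    and "u \<in> carrier (free_group (cyc_gens n))" and "u \<noteq> []"
    and "w = u \<otimes>\<^bsub>free_group (cyc_gens n)\<^esub> word_inv ((shift n ^^ (n div 2)) u)"
    and "length w = k"
    and "alternating w"
    and "\<not> proper_power (free_group (cyc_gens n)) w"
    and "irreducible_presentation n w"
  shows "special 2 k \<nu> (cyclic_presentation n w) \<longleftrightarrow>
    length u = n div 2 \<and> n div 2 \<ge> 3 \<and> odd (n div 2) \<and> \<nu> = 2 \<and>
    pm_form n {c. odd c \<and> 1 \<le> c \<and> c \<le> (int n - 4) div 2} (fst (AB_bar n u)) \<and>
    pm_form n {c. odd c \<and> 1 \<le> c \<and> c \<le> (int n - 4) div 2} (snd (AB_bar n u))"
proof -
  interpret cyclic_relator n u w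
    by unfold_locales (use assms in auto)
  show ?thesis using special_iff[OF assms(9)] assms(6) by simp
qed

end
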